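(* Let $\mathcal{Q}$ be a node query expressed by a key-invariant LocalMax GNN (with arbitrary combination functions). Then $\mathcal{Q}$ is definable in order-invariant first-order logic, i.e. $\mathcal{Q}\in\mathrm{OrdInvFO}$.
   Context: Fix a finite set $\Pi=\{p_1,\dots,p_n\}$ of propositions. A graph is $G=(V,E,\mathrm{lab})$ with $V$ finite, $E\subseteq V\times V$ irreflexive and symmetric, $\mathrm{lab}:V\to\{0,1\}^n$; a pointed graph $G^u$ has distinguished node $u$; a node query is an isomorphism-closed class of pointed graphs. A keyed extension adds an injective $\mathrm{key}:V\to\mathbb{R}$. A GNN is a sequence of layers $(\mathrm{agg}_i,\mathrm{com}_i)_{i=1}^\ell$, $\mathrm{com}_i:\mathbb{R}^{2D_i}\to\mathbb{R}^{D_{i+1}}$ arbitrary functions, $D_1=n+1$, $D_{\ell+1}=1$; on a keyed graph the initial embedding is $\mathrm{lab}(v)\oplus(\mathrm{key}(v))$, each layer computes $\mathrm{emb}'(u)=\mathrm{com}_i(\mathrm{emb}(u),\mathrm{agg}_i(\{\!\{\mathrm{emb}(v)\mid(u,v)\in E\}\!\}))$, output is the final value at the distinguished node. LocalMax: each $\mathrm{agg}_i$ is coordinate-wise max (empty max $=0$). Accept iff output $>0$; key-invariant if for every pointed graph all or none of its keyed extensions are accepted; then it expresses the query of pointed graphs whose keyed extensions are accepted. An $\mathrm{FO}(<)$ formula is a first-order formula built from atoms $E(x,y)$, $x<y$, $x=y$, $p(x)$ ($p\in\Pi$), interpreted over graphs expanded with a linear order $<$ on $V$. A formula $\phi(x)$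 with one free variable is order-invariant if for every pointed graph $G^u$ and all linear orders $<,<'$ on $V(G)$, $(G,<)\models\phi(u)$ iff $(G,<')\models\phi(u)$; it then defines the node query of pointed graphs $G^u$ with $(G,<)\models\phi(u)$ for some (equivalently every) linear order. $\mathrm{OrdInvFO}$ is the class of node queries so defined. *)

theory Defs
  imports Complex_Main "HOL-Library.Multiset" "HOL-Library.Infinite_Typeclass"
begin

section \<open>Labelled graphs and node queries\<close>

text \<open>
  The propositions are \<open>p\<^sub>0, \<dots>, p\<^sub>n\<^sub>-\<^sub>1\<close>, given by their indices below \<open>n\<close>; a label in
  \<open>{0,1}\<^sup>n\<close> is a Boolean list of length \<open>n\<close>. Vertices are drawn from a type \<open>'v\<close>; for infinite
  \<open>'v\<close>, every finite graph has an isomorphic copy over \<open>'v\<close>. The values of \<open>lab\<close> outside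
  \<open>verts\<close> are irrelevant.
\<close>

record 'v lgraph =
  verts :: "'v set"
  edges :: "('v \<times> 'v) set"
  lab   :: "'v \<Rightarrow> bool list"

definition is_graph :: "nat \<Rightarrow> 'v lgraph \<Rightarrow> bool" where
  "is_graph n G \<longleftrightarrow>
     finite (verts G) \<and> edges G \<subseteq> verts G \<times> verts G \<and> irrefl (edges G) \<and> sym (edges G) \<and>
     (\<forall>v\<in>verts G. length (lab G v) = n)"

definition pointed_graphs :: "nat \<Rightarrow> ('v lgraph \<times> 'v) set" where
  "pointed_graphs n = {(G, u). is_graph n G \<and> u \<in> verts G}"

definition pointed_iso :: "'v lgraph \<times> 'v \<Rightarrow> 'v lgraph \<times> 'v \<Rightarrow> bool" where
  "pointed_iso P P' \<longleftrightarrow>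
     (\<exists>f. bij_betw f (verts (fst P)) (verts (fst P')) \<and>
        (\<forall>v\<in>verts (fst P). \<forall>w\<in>verts (fst P).
           (v, w) \<in> edges (fst P) \<longleftrightarrow> (f v, f w) \<in> edges (fst P')) \<and>
        (\<forall>v\<in>verts (fst P). lab (fst P') (f v) = lab (fst P) v) \<and>
        f (snd P) = snd P')"

definition node_query :: "nat \<Rightarrow> ('v lgraph \<times> 'v) set \<Rightarrow> bool" where
  "node_query n Q \<longleftrightarrow>
     Q \<subseteq> pointed_graphs n \<and>
     (\<forall>P\<in>Q. \<forall>P'\<in>pointed_graphs n. pointed_iso P P' \<longrightarrow> P' \<in> Q)"

section \<open>Graph neural networks\<close>

definition vec :: "nat \<Rightarrow> real list set" where
  "vec d = {x. length x = d}"

record layer =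
  agg :: "real list multiset \<Rightarrow> real list"
  com :: "real list \<Rightarrow> real list"

text \<open>
  \<open>dims\<close> lists the \<open>l + 1\<close> dimensions of a network with \<open>l\<close> layers: layer number \<open>i\<close> (counted
  from 0) maps embeddings of dimension \<open>dims ! i\<close> to embeddings of dimension \<open>dims ! Suc i\<close>.
\<close>

record gnn =
  dims   :: "nat list"
  layers :: "layer list"

definition is_gnn :: "nat \<Rightarrow> gnn \<Rightarrow> bool" where
  "is_gnn n N \<longleftrightarrow>
     length (dims N) = Suc (length (layers N)) \<and>
     hd (dims N) = n + 1 \<and> last (dims N) = 1 \<and>
     (\<forall>i<length (layers N).
        (\<forall>M. set_mset M \<subseteq> vec (dims N ! i) \<longrightarrow> agg (layers N ! i) M \<in> vec (dims N ! i)) \<and>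
        (\<forall>x\<in>vec (2 * dims N ! i). com (layers N ! i) x \<in> vec (dims N ! Suc i)))"

definition coord_max :: "nat \<Rightarrow> real list multiset \<Rightarrow> real list" where
  "coord_max d M =
     (if M = {#} then replicate d 0
      else map (\<lambda>j. Max ((\<lambda>x. x ! j) ` set_mset M)) [0..<d])"

definition local_max :: "gnn \<Rightarrow> bool" where
  "local_max N \<longleftrightarrow>
     (\<forall>i<length (layers N). \<forall>M. set_mset M \<subseteq> vec (dims N ! i) \<longrightarrow>
        agg (layers N ! i) M = coord_max (dims N ! i) M)"

definition initial_emb :: "'v lgraph \<Rightarrow> ('v \<Rightarrow> real) \<Rightarrow> 'v \<Rightarrow> real list" where
  "initial_emb G key v = map of_bool (lab G v) @ [key v]"

definition apply_layer ::
  "'v lgraph \<Rightarrow> layer \<Rightarrow> ('v \<Rightarrow> real list) \<Rightarrow> 'v \<Rightarrow> real list" where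
  "apply_layer G L emb u =
     com L (emb u @ agg L (image_mset emb (mset_set {v. (u, v) \<in> edges G})))"

definition gnn_output :: "gnn \<Rightarrow> 'v lgraph \<Rightarrow> ('v \<Rightarrow> real) \<Rightarrow> 'v \<Rightarrow> real" where
  "gnn_output N G key u = hd (fold (apply_layer G) (layers N) (initial_emb G key) u)"

definition gnn_accepts :: "gnn \<Rightarrow> 'v lgraph \<Rightarrow> ('v \<Rightarrow> real) \<Rightarrow> 'v \<Rightarrow> bool" where
  "gnn_accepts N G key u \<longleftrightarrow> gnn_output N G key u > 0"

definition keyings :: "'v lgraph \<Rightarrow> ('v \<Rightarrow> real) set" where
  "keyings G = {key. inj_on key (verts G)}"

definition key_invariant :: "'v itself \<Rightarrow> nat \<Rightarrow> gnn \<Rightarrow> bool" where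
  "key_invariant _ n N \<longleftrightarrow>
     (\<forall>(G :: 'v lgraph, u)\<in>pointed_graphs n.
        (\<forall>key\<in>keyings G. gnn_accepts N G key u) \<or> (\<forall>key\<in>keyings G. \<not> gnn_accepts N G key u))"

text \<open>Intended for key-invariant networks only.\<close>

definition gnn_query :: "nat \<Rightarrow> gnn \<Rightarrow> ('v lgraph \<times> 'v) set" where
  "gnn_query n N =
     {(G, u). (G, u) \<in> pointed_graphs n \<and> (\<forall>key\<in>keyings G. gnn_accepts N G key u)}"

section \<open>Order-invariant first-order logic\<close>

text \<open>
  Variables are natural numbers; the first argument of \<open>PropAt\<close> is the index of a proposition.
\<close>

datatype fo =
    EdgeAt nat nat
  | LessAt nat nat
  | EqAt nat nat
  | PropAt nat nat
  | Neg fo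
  | Conj fo fo
  | Disj fo fo
  | Exists nat fo
  | Forall nat fo

primrec fv :: "fo \<Rightarrow> nat set" where
  "fv (EdgeAt x y) = {x, y}"
| "fv (LessAt x y) = {x, y}"
| "fv (EqAt x y) = {x, y}"
| "fv (PropAt p x) = {x}"
| "fv (Neg \<phi>) = fv \<phi>"
| "fv (Conj \<phi> \<psi>) = fv \<phi> \<union> fv \<psi>"
| "fv (Disj \<phi> \<psi>) = fv \<phi> \<union> fv \<psi>"
| "fv (Exists x \<phi>) = fv \<phi> - {x}"
| "fv (Forall x \<phi>) = fv \<phi> - {x}"

primrec props :: "fo \<Rightarrow> nat set" where
  "props (EdgeAt x y) = {}"
| "props (LessAt x y) = {}"
| "props (EqAt x y) = {}"
| "props (PropAt p x) = {p}"
| "props (Neg \<phi>) = props \<phi>"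
| "props (Conj \<phi> \<psi>) = props \<phi> \<union> props \<psi>"
| "props (Disj \<phi> \<psi>) = props \<phi> \<union> props \<psi>"
| "props (Exists x \<phi>) = props \<phi>"
| "props (Forall x \<phi>) = props \<phi>"

primrec sat :: "'v lgraph \<Rightarrow> ('v \<times> 'v) set \<Rightarrow> (nat \<Rightarrow> 'v) \<Rightarrow> fo \<Rightarrow> bool" where
  "sat G r \<sigma> (EdgeAt x y) \<longleftrightarrow> (\<sigma> x, \<sigma> y) \<in> edges G"
| "sat G r \<sigma> (LessAt x y) \<longleftrightarrow> (\<sigma> x, \<sigma> y) \<in> r"
| "sat G r \<sigma> (EqAt x y) \<longleftrightarrow> \<sigma> x = \<sigma> y"
| "sat G r \<sigma> (PropAt p x) \<longleftrightarrow> lab G (\<sigma> x) ! p"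
| "sat G r \<sigma> (Neg \<phi>) \<longleftrightarrow> \<not> sat G r \<sigma> \<phi>"
| "sat G r \<sigma> (Conj \<phi> \<psi>) \<longleftrightarrow> sat G r \<sigma> \<phi> \<and> sat G r \<sigma> \<psi>"
| "sat G r \<sigma> (Disj \<phi> \<psi>) \<longleftrightarrow> sat G r \<sigma> \<phi> \<or> sat G r \<sigma> \<psi>"
| "sat G r \<sigma> (Exists x \<phi>) \<longleftrightarrow> (\<exists>v\<in>verts G. sat G r (\<sigma>(x := v)) \<phi>)"
| "sat G r \<sigma> (Forall x \<phi>) \<longleftrightarrow> (\<forall>v\<in>verts G. sat G r (\<sigma>(x := v)) \<phi>)"

definition vertex_orders :: "'v lgraph \<Rightarrow> ('v \<times> 'v) set set" where
  "vertex_orders G = {r. r \<subseteq> verts G \<times> verts G \<and> strict_linear_order_on (verts G) r}"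

definition unary_formula :: "nat \<Rightarrow> fo \<Rightarrow> bool" where
  "unary_formula n \<phi> \<longleftrightarrow> (\<exists>x. fv \<phi> = {x}) \<and> props \<phi> \<subseteq> {..<n}"

text \<open>
  A formula with a single free variable is evaluated at \<open>u\<close> by using the constant assignment
  \<open>\<lambda>_. u\<close>.
\<close>

definition order_invariant :: "'v itself \<Rightarrow> nat \<Rightarrow> fo \<Rightarrow> bool" where
  "order_invariant _ n \<phi> \<longleftrightarrow>
     (\<forall>(G :: 'v lgraph, u)\<in>pointed_graphs n. \<forall>r\<in>vertex_orders G. \<forall>r'\<in>vertex_orders G.
        sat G r (\<lambda>_. u) \<phi> \<longleftrightarrow> sat G r' (\<lambda>_. u) \<phi>)"

definition fo_query :: "nat \<Rightarrow> fo \<Rightarrow> ('v lgraph \<times> 'v) set" where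
  "fo_query n \<phi> =
     {(G, u). (G, u) \<in> pointed_graphs n \<and> (\<exists>r\<in>vertex_orders G. sat G r (\<lambda>_. u) \<phi>)}"

definition OrdInvFO :: "nat \<Rightarrow> ('v lgraph \<times> 'v) set set" where
  "OrdInvFO n =
     {fo_query n \<phi> | \<phi>. unary_formula n \<phi> \<and> order_invariant TYPE('v) n \<phi>}"

end

theory Submission
  imports Defs "HOL-Library.Ramsey" "HOL-Library.Countable" "HOL-Library.Nat_Bijection"
    "HOL-Library.FuncSet"
begin

text \<open>
  Since a coordinatewise maximum is attained, each embedding computed by a LocalMax network is the
  value of one of finitely many functions at the keys of boundedly many vertices. By Ramsey's
  theorem there are infinitely many reals on which every comparison between two such functions
  depends only on the order type of their arguments. If the keys are drawn from these reals in the
  order given by \<open><\<close>, all comparisons become first-order over \<open><\<close>, and by induction on the layers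
  so does the statement that an embedding equals a given function of given keys. The resulting
  formula expresses acceptance under one particular keying, which by key-invariance is the query.
\<close>

section \<open>Definable predicates\<close>

text \<open>Combination functions are arbitrary, so no formula can evaluate them. A real value is
  therefore handled only through a name: a term together with vertices whose keys are plugged in. A
  combination function occurs only inside terms. One value may have many names, so it is comparisons
  between terms that must be controlled. For a fixed network there are finitely many of these, each
  of bounded arity whatever the graph; hence one application of Ramsey's theorem serves all layers
  and all graphs. The set of reals has to be infinite because graphs have no size bound. The formula
  is not made order-invariant by construction: for each order it describes acceptance under the
  keying attached to that order, and key-invariance makes these answers agree.\<close>

lemma finite_fv: "finite (fv \<phi>)"
  by (induction \<phi>) auto

lemma sat_cong_fv: "(\<And>x. x \<in> fv \<phi> \<Longrightarrow> \<sigma> x = \<tau> x) \<Longrightarrow> sat G r \<sigma> \<phi> = sat G r \<tau> \<phi>"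
proof (induction \<phi> arbitrary: \<sigma> \<tau>)
  case (Neg \<phi>)
  from Neg.IH[of \<sigma> \<tau>] Neg.prems show ?case by simp
next
  case (Conj \<phi>1 \<phi>2)
  from Conj.IH[of \<sigma> \<tau>] Conj.prems show ?case by simp
next
  case (Disj \<phi>1 \<phi>2)
  from Disj.IH[of \<sigma> \<tau>] Disj.prems show ?case by simp
next
  case (Exists x \<phi>)
  have "sat G r (\<sigma>(x := v)) \<phi> = sat G r (\<tau>(x := v)) \<phi>" for v
    by (rule Exists.IH) (use Exists.prems in auto)
  then show ?case by simp
next
  case (Forall x \<phi>)
  have "sat G r (\<sigma>(x := v)) \<phi> = sat G r (\<tau>(x := v)) \<phi>" for v
    by (rule Forall.IH) (use Forall.prems in auto)
  then show ?case by simp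
qed auto

section \<open>Renaming variables and quantifying blocks of variables\<close>

lemma sat_rename_bound:
  assumes "y \<notin> \<rho> ` fv \<phi>"
  shows "sat G r (\<lambda>a. (\<sigma>(y := v)) ((\<rho>(x := y)) a)) \<phi> = sat G r ((\<lambda>a. \<sigma> (\<rho> a))(x := v)) \<phi>"
  by (rule sat_cong_fv) (use assms in auto)

text \<open>Stated as existence so that the choice of fresh bound variables stays hidden. Renamings
  that merge variables are included; the collapse to one variable in
  \<open>unary_formula_of_definable\<close> is of this kind.\<close>

lemma ex_renaming:
  "\<exists>\<psi>. fv \<psi> \<subseteq> \<rho> ` fv \<phi> \<and> props \<psi> = props \<phi> \<and>
     (\<forall>(G :: 'v lgraph) r \<sigma>. sat G r \<sigma> \<psi> = sat G r (\<lambda>a. \<sigma> (\<rho> a)) \<phi>)"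
proof (induction \<phi> arbitrary: \<rho>)
  case (EdgeAt x y)
  show ?case by (rule exI[of _ "EdgeAt (\<rho> x) (\<rho> y)"]) simp
next
  case (LessAt x y)
  show ?case by (rule exI[of _ "LessAt (\<rho> x) (\<rho> y)"]) simp
next
  case (EqAt x y)
  show ?case by (rule exI[of _ "EqAt (\<rho> x) (\<rho> y)"]) simp
next
  case (PropAt p x)
  show ?case by (rule exI[of _ "PropAt p (\<rho> x)"]) simp
next
  case (Neg \<phi>)
  obtain \<psi> where "fv \<psi> \<subseteq> \<rho> ` fv \<phi>" "props \<psi> = props \<phi>"
    "\<forall>(G :: 'v lgraph) r \<sigma>. sat G r \<sigma> \<psi> = sat G r (\<lambda>a. \<sigma> (\<rho> a)) \<phi>"
    using Neg.IH[of \<rho>] by blast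
  then show ?case by (intro exI[of _ "Neg \<psi>"]) auto
next
  case (Conj \<phi>1 \<phi>2)
  obtain \<psi>1 where "fv \<psi>1 \<subseteq> \<rho> ` fv \<phi>1" "props \<psi>1 = props \<phi>1"
    "\<forall>(G :: 'v lgraph) r \<sigma>. sat G r \<sigma> \<psi>1 = sat G r (\<lambda>a. \<sigma> (\<rho> a)) \<phi>1"
    using Conj.IH(1)[of \<rho>] by blast
  moreover obtain \<psi>2 where "fv \<psi>2 \<subseteq> \<rho> ` fv \<phi>2" "props \<psi>2 = props \<phi>2"
    "\<forall>(G :: 'v lgraph) r \<sigma>. sat G r \<sigma> \<psi>2 = sat G r (\<lambda>a. \<sigma> (\<rho> a)) \<phi>2"
    using Conj.IH(2)[of \<rho>] by blast
  ultimately show ?case by (intro exI[of _ "Conj \<psi>1 \<psi>2"]) auto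
next
  case (Disj \<phi>1 \<phi>2)
  obtain \<psi>1 where "fv \<psi>1 \<subseteq> \<rho> ` fv \<phi>1" "props \<psi>1 = props \<phi>1"
    "\<forall>(G :: 'v lgraph) r \<sigma>. sat G r \<sigma> \<psi>1 = sat G r (\<lambda>a. \<sigma> (\<rho> a)) \<phi>1"
    using Disj.IH(1)[of \<rho>] by blast
  moreover obtain \<psi>2 where "fv \<psi>2 \<subseteq> \<rho> ` fv \<phi>2" "props \<psi>2 = props \<phi>2"
    "\<forall>(G :: 'v lgraph) r \<sigma>. sat G r \<sigma> \<psi>2 = sat G r (\<lambda>a. \<sigma> (\<rho> a)) \<phi>2"
    using Disj.IH(2)[of \<rho>] by blast
  ultimately show ?case by (intro exI[of _ "Disj \<psi>1 \<psi>2"]) auto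
next
  case (Exists x \<phi>)
  \<comment> \<open>As \<open>\<rho>\<close> may identify variables, \<open>\<rho> x\<close> can
    coincide with the image of a free variable and would capture it; a fresh \<open>y\<close>
    cannot.\<close>
  obtain y where y: "y \<notin> \<rho> ` fv \<phi>"
    using ex_new_if_finite[OF infinite_UNIV_nat finite_imageI[OF finite_fv]] by blast
  obtain \<psi> where "fv \<psi> \<subseteq> \<rho>(x := y) ` fv \<phi>" "props \<psi> = props \<phi>"
    "\<forall>(G :: 'v lgraph) r \<sigma>. sat G r \<sigma> \<psi> = sat G r (\<lambda>a. \<sigma> ((\<rho>(x := y)) a)) \<phi>"
    using Exists.IH[of "\<rho>(x := y)"] by blast
  moreover from this(1) have "fv \<psi> - {y} \<subseteq> \<rho> ` (fv \<phi> - {x})"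
    by (auto split: if_splits)
  ultimately show ?case
    by (intro exI[of _ "Exists y \<psi>"]) (simp add: sat_rename_bound[OF y] del: fun_upd_apply)
next
  case (Forall x \<phi>)
  obtain y where y: "y \<notin> \<rho> ` fv \<phi>"
    using ex_new_if_finite[OF infinite_UNIV_nat finite_imageI[OF finite_fv]] by blast
  obtain \<psi> where "fv \<psi> \<subseteq> \<rho>(x := y) ` fv \<phi>" "props \<psi> = props \<phi>"
    "\<forall>(G :: 'v lgraph) r \<sigma>. sat G r \<sigma> \<psi> = sat G r (\<lambda>a. \<sigma> ((\<rho>(x := y)) a)) \<phi>"
    using Forall.IH[of "\<rho>(x := y)"] by blast
  moreover from this(1) have "fv \<psi> - {y} \<subseteq> \<rho> ` (fv \<phi> - {x})"
    by (auto split: if_splits)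
  ultimately show ?case
    by (intro exI[of _ "Forall y \<psi>"]) (simp add: sat_rename_bound[OF y] del: fun_upd_apply)
qed

lemma sat_foldr_Exists:
  "sat G r \<sigma> (foldr Exists xs \<phi>) \<longleftrightarrow>
     (\<exists>\<tau>. (\<forall>x. x \<notin> set xs \<longrightarrow> \<tau> x = \<sigma> x) \<and> (\<forall>x\<in>set xs. \<tau> x \<in> verts G) \<and> sat G r \<tau> \<phi>)"
proof (induction xs arbitrary: \<sigma>)
  case Nil
  have "\<tau> = \<sigma>" if "\<forall>x. \<tau> x = \<sigma> x" for \<tau>
    using that by auto
  then show ?case by auto
next
  case (Cons x xs)
  show ?case
  proof
    assume "sat G r \<sigma> (foldr Exists (x # xs) \<phi>)"
    then obtain v \<tau> where v: "v \<in> verts G" and \<tau>: "\<forall>y. y \<notin> set xs \<longrightarrow> \<tau> y = (\<sigma>(x := v)) y"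
      "\<forall>y\<in>set xs. \<tau> y \<in> verts G" "sat G r \<tau> \<phi>"
      using Cons.IH by auto
    \<comment> \<open>If \<open>x\<close> is quantified again further inside, the inner choice
      overrides \<open>v\<close>.\<close>
    have "\<tau> x \<in> verts G"
      using v \<tau>(1,2) by (cases "x \<in> set xs") auto
    with \<tau> show "\<exists>\<tau>. (\<forall>y. y \<notin> set (x # xs) \<longrightarrow> \<tau> y = \<sigma> y) \<and> (\<forall>y\<in>set (x # xs). \<tau> y \<in> verts G) \<and>
        sat G r \<tau> \<phi>"
      by (intro exI[of _ \<tau>]) auto
  next
    assume "\<exists>\<tau>. (\<forall>y. y \<notin> set (x # xs) \<longrightarrow> \<tau> y = \<sigma> y) \<and> (\<forall>y\<in>set (x # xs). \<tau> y \<in> verts G) \<and>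
        sat G r \<tau> \<phi>"
    then obtain \<tau> where \<tau>: "\<forall>y. y \<notin> set (x # xs) \<longrightarrow> \<tau> y = \<sigma> y"
      "\<forall>y\<in>set (x # xs). \<tau> y \<in> verts G" "sat G r \<tau> \<phi>"
      by blast
    then have "sat G r (\<sigma>(x := \<tau> x)) (foldr Exists xs \<phi>)"
      unfolding Cons.IH by (intro exI[of _ \<tau>]) auto
    with \<tau>(2) show "sat G r \<sigma> (foldr Exists (x # xs) \<phi>)"
      by auto
  qed
qed

text \<open>
  Arguments of a predicate are indexed by a countable type instead of by variables, so that blocks
  of arguments can be combined and quantified as sum types without managing variable names.
\<close>

definition definable ::
  "nat \<Rightarrow> ('v lgraph \<Rightarrow> ('v \<times> 'v) set \<Rightarrow> ('i::countable \<Rightarrow> 'v) \<Rightarrow> bool) \<Rightarrow> bool" where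
  "definable n P \<longleftrightarrow>
     (\<exists>\<phi>. props \<phi> \<subseteq> {..<n} \<and>
        (\<forall>G r \<sigma>. is_graph n G \<longrightarrow> r \<in> vertex_orders G \<longrightarrow> range \<sigma> \<subseteq> verts G \<longrightarrow>
           P G r \<sigma> = sat G r (\<lambda>a. \<sigma> (from_nat a)) \<phi>))"

lemma definableI:
  assumes "props \<phi> \<subseteq> {..<n}"
    and "\<And>G r \<sigma>. is_graph n G \<Longrightarrow> r \<in> vertex_orders G \<Longrightarrow> range \<sigma> \<subseteq> verts G \<Longrightarrow>
      P G r \<sigma> = sat G r (\<lambda>a. \<sigma> (from_nat a)) \<phi>"
  shows "definable n P"
  unfolding definable_def using assms by blast

lemma definableE:
  assumes "definable n P"
  obtains \<phi> where "props \<phi> \<subseteq> {..<n}"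
    and "\<And>G r \<sigma>. is_graph n G \<Longrightarrow> r \<in> vertex_orders G \<Longrightarrow> range \<sigma> \<subseteq> verts G \<Longrightarrow>
      P G r \<sigma> = sat G r (\<lambda>a. \<sigma> (from_nat a)) \<phi>"
  using assms unfolding definable_def by blast

lemma definable_cong:
  assumes "definable n P"
    and "\<And>G r \<sigma>. is_graph n G \<Longrightarrow> r \<in> vertex_orders G \<Longrightarrow> range \<sigma> \<subseteq> verts G \<Longrightarrow>
      P' G r \<sigma> = P G r \<sigma>"
  shows "definable n P'"
  using assms(1) by (rule definableE) (rule definableI, auto simp: assms(2))

section \<open>Closure properties of definability\<close>

lemma definable_edge: "definable n (\<lambda>G r \<sigma>. (\<sigma> i, \<sigma> j) \<in> edges G)"
  by (rule definableI[of "EdgeAt (to_nat i) (to_nat j)"]) auto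

lemma definable_less: "definable n (\<lambda>G r \<sigma>. (\<sigma> i, \<sigma> j) \<in> r)"
  by (rule definableI[of "LessAt (to_nat i) (to_nat j)"]) auto

lemma definable_prop: "p < n \<Longrightarrow> definable n (\<lambda>G r \<sigma>. lab G (\<sigma> i) ! p)"
  by (rule definableI[of "PropAt p (to_nat i)"]) auto

lemma definable_const: "definable n (\<lambda>G r \<sigma>. b)"
  by (cases b) (rule definableI[of "EqAt 0 0"] definableI[of "Neg (EqAt 0 0)"]; simp)+

lemma definable_not:
  assumes "definable n P"
  shows "definable n (\<lambda>G r \<sigma>. \<not> P G r \<sigma>)"
  using assms
proof (rule definableE)
  fix \<phi>
  assume "props \<phi> \<subseteq> {..<n}"
    and "\<And>G r \<sigma>. is_graph n G \<Longrightarrow> r \<in> vertex_orders G \<Longrightarrow> range \<sigma> \<subseteq> verts G \<Longrightarrow>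
      P G r \<sigma> = sat G r (\<lambda>a. \<sigma> (from_nat a)) \<phi>"
  then show ?thesis by (intro definableI[of "Neg \<phi>"]) auto
qed

lemma definable_conj:
  assumes "definable n P" and "definable n Q"
  shows "definable n (\<lambda>G r \<sigma>. P G r \<sigma> \<and> Q G r \<sigma>)"
  using assms(1)
proof (rule definableE)
  fix \<phi>
  assume \<phi>: "props \<phi> \<subseteq> {..<n}"
    "\<And>G r \<sigma>. is_graph n G \<Longrightarrow> r \<in> vertex_orders G \<Longrightarrow> range \<sigma> \<subseteq> verts G \<Longrightarrow>
      P G r \<sigma> = sat G r (\<lambda>a. \<sigma> (from_nat a)) \<phi>"
  show ?thesis
    using assms(2)
  proof (rule definableE)
    fix \<psi>
    assume "props \<psi> \<subseteq> {..<n}"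
      and "\<And>G r \<sigma>. is_graph n G \<Longrightarrow> r \<in> vertex_orders G \<Longrightarrow> range \<sigma> \<subseteq> verts G \<Longrightarrow>
        Q G r \<sigma> = sat G r (\<lambda>a. \<sigma> (from_nat a)) \<psi>"
    with \<phi> show ?thesis by (intro definableI[of "Conj \<phi> \<psi>"]) auto
  qed
qed

lemma definable_disj:
  assumes "definable n P" and "definable n Q"
  shows "definable n (\<lambda>G r \<sigma>. P G r \<sigma> \<or> Q G r \<sigma>)"
  by (rule definable_cong[OF definable_not[OF definable_conj[OF assms[THEN definable_not]]]]) simp

lemma definable_imp:
  assumes "definable n P" and "definable n Q"
  shows "definable n (\<lambda>G r \<sigma>. P G r \<sigma> \<longrightarrow> Q G r \<sigma>)"
  by (rule definable_cong[OF definable_disj[OF definable_not[OF assms(1)] assms(2)]]) simp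

lemma definable_iff:
  assumes "definable n P" and "definable n Q"
  shows "definable n (\<lambda>G r \<sigma>. P G r \<sigma> \<longleftrightarrow> Q G r \<sigma>)"
  using definable_conj[OF definable_imp[OF assms] definable_imp[OF assms(2,1)]]
  by (simp only: iff_conv_conj_imp[symmetric])

lemma definable_bex:
  assumes "finite I" and "\<And>i. i \<in> I \<Longrightarrow> definable n (P i)"
  shows "definable n (\<lambda>G r \<sigma>. \<exists>i\<in>I. P i G r \<sigma>)"
  using assms
proof (induction I rule: finite_induct)
  case empty
  show ?case using definable_const[of n False] by simp
next
  case (insert i I)
  then show ?case using definable_disj[of n "P i"] by simp
qed

lemma definable_ball:
  assumes "finite I" and "\<And>i. i \<in> I \<Longrightarrow> definable n (P i)"
  shows "definable n (\<lambda>G r \<sigma>. \<forall>i\<in>I. P i G r \<sigma>)"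
  using definable_not[OF definable_bex[OF assms(1) definable_not[OF assms(2)]]] by simp

lemma definable_reindex:
  fixes P :: "'v lgraph \<Rightarrow> ('v \<times> 'v) set \<Rightarrow> ('i::countable \<Rightarrow> 'v) \<Rightarrow> bool"
    and \<rho> :: "'i \<Rightarrow> 'j::countable"
  assumes "definable n P"
  shows "definable n (\<lambda>G r \<sigma>. P G r (\<lambda>i. \<sigma> (\<rho> i)))"
  using assms
proof (rule definableE)
  fix \<phi>
  assume \<phi>: "props \<phi> \<subseteq> {..<n}"
    "\<And>G r \<sigma>. is_graph n G \<Longrightarrow> r \<in> vertex_orders G \<Longrightarrow> range \<sigma> \<subseteq> verts G \<Longrightarrow>
      P G r \<sigma> = sat G r (\<lambda>a. \<sigma> (from_nat a)) \<phi>"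
  obtain \<psi> where \<psi>: "props \<psi> = props \<phi>"
    "\<And>(G :: 'v lgraph) r \<sigma>. sat G r \<sigma> \<psi> = sat G r (\<lambda>a. \<sigma> (to_nat (\<rho> (from_nat a)))) \<phi>"
    using ex_renaming[of "\<lambda>a. to_nat (\<rho> (from_nat a))" \<phi>] by blast
  show ?thesis
  proof (rule definableI)
    show "props \<psi> \<subseteq> {..<n}" using \<phi> \<psi> by simp
    fix G :: "'v lgraph" and r and \<sigma> :: "'j \<Rightarrow> 'v"
    assume "is_graph n G" "r \<in> vertex_orders G" "range \<sigma> \<subseteq> verts G"
    then show "P G r (\<lambda>i. \<sigma> (\<rho> i)) = sat G r (\<lambda>a. \<sigma> (from_nat a)) \<psi>"
      using \<phi>(2)[of G r "\<lambda>i. \<sigma> (\<rho> i)"] by (auto simp: \<psi>)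
  qed
qed

text \<open>A whole infinite sequence \<open>y\<close> is quantified at once. A formula sees only
  finitely many entries; those become quantifiers, and the others may be any vertices.\<close>

lemma definable_ex:
  fixes P :: "'v lgraph \<Rightarrow> ('v \<times> 'v) set \<Rightarrow> ('i::countable \<Rightarrow> 'v) \<Rightarrow> (nat \<Rightarrow> 'v) \<Rightarrow> bool"
  assumes "definable n (\<lambda>G r \<tau>. P G r (\<lambda>i. \<tau> (Inl i)) (\<lambda>k. \<tau> (Inr k)))"
  shows "definable n (\<lambda>G r \<sigma>. \<exists>y. range y \<subseteq> verts G \<and> P G r \<sigma> y)"
  using assms
proof (rule definableE)
  fix \<phi>
  assume \<phi>: "props \<phi> \<subseteq> {..<n}"
    "\<And>G r \<tau>. is_graph n G \<Longrightarrow> r \<in> vertex_orders G \<Longrightarrow> range \<tau> \<subseteq> verts G \<Longrightarrow>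
      P G r (\<lambda>i. \<tau> (Inl i)) (\<lambda>k. \<tau> (Inr k)) = sat G r (\<lambda>a. \<tau> (from_nat a)) \<phi>"
  \<comment> \<open>Odd variables hold the quantified block, even ones the parameters.\<close>
  define \<pi> :: "nat \<Rightarrow> nat" where
    "\<pi> a = (case from_nat a :: 'i + nat of Inl i \<Rightarrow> 2 * to_nat i | Inr k \<Rightarrow> 2 * k + 1)" for a
  obtain \<psi> where \<psi>: "props \<psi> = props \<phi>"
    "\<And>(G :: 'v lgraph) r \<sigma>. sat G r \<sigma> \<psi> = sat G r (\<lambda>a. \<sigma> (\<pi> a)) \<phi>"
    using ex_renaming[of \<pi> \<phi>] by blast
  obtain xs where xs: "set xs = {x \<in> fv \<psi>. odd x}"
    using finite_list[of "{x \<in> fv \<psi>. odd x}"] finite_fv by auto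
  have props_foldr: "props (foldr Exists zs \<chi>) = props \<chi>" for zs \<chi>
    by (induction zs) auto
  \<comment> \<open>The quantifiers bind all odd free variables of \<open>\<psi>\<close>; halving
    returns a remaining even variable \<open>2 * b\<close> to its parameter number
    \<open>b\<close>.\<close>
  obtain \<chi> where \<chi>: "props \<chi> = props \<phi>"
    "\<And>(G :: 'v lgraph) r \<sigma>. sat G r \<sigma> \<chi> = sat G r (\<lambda>a. \<sigma> (a div 2)) (foldr Exists xs \<psi>)"
    using ex_renaming[of "\<lambda>a. a div 2" "foldr Exists xs \<psi>"] \<psi> by (auto simp: props_foldr)
  show ?thesis
  proof (rule definableI)
    show "props \<chi> \<subseteq> {..<n}" using \<phi> \<chi> by simp
    fix G :: "'v lgraph" and r and \<sigma> :: "'i \<Rightarrow> 'v"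
    assume G: "is_graph n G" "r \<in> vertex_orders G" and \<sigma>: "range \<sigma> \<subseteq> verts G"
    have P_iff: "P G r \<sigma> y = sat G r (\<lambda>a. case_sum \<sigma> y (from_nat a)) \<phi>" if "range y \<subseteq> verts G" for y
    proof -
      have "case_sum \<sigma> y z \<in> verts G" for z
        using \<sigma> that by (cases z) auto
      then show ?thesis
        using \<phi>(2)[OF G, of "case_sum \<sigma> y"] by (auto simp: image_subset_iff)
    qed
    define \<sigma>' where "\<sigma>' = (\<lambda>a. \<sigma> (from_nat (a div 2)))"
    have "(\<exists>y. range y \<subseteq> verts G \<and> P G r \<sigma> y) \<longleftrightarrow>
      (\<exists>\<tau>. (\<forall>x. x \<notin> set xs \<longrightarrow> \<tau> x = \<sigma>' x) \<and> (\<forall>x\<in>set xs. \<tau> x \<in> verts G) \<and> sat G r \<tau> \<psi>)"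
      (is "?L \<longleftrightarrow> ?R")
    proof
      assume ?L
      then obtain y where y: "range y \<subseteq> verts G" "P G r \<sigma> y" by blast
      define \<tau> where "\<tau> a = (if a \<in> set xs then y (a div 2) else \<sigma>' a)" for a
      \<comment> \<open>This assignment puts all of \<open>y\<close> on the odd variables and so
        fits \<open>\<pi>\<close> exactly; it agrees with \<open>\<tau>\<close> on the free
        variables of \<open>\<psi>\<close>.\<close>
      define \<tau>' where "\<tau>' a = (if odd a then y (a div 2) else \<sigma>' a)" for a
      have "\<tau>' (\<pi> a) = case_sum \<sigma> y (from_nat a)" for a
        by (auto simp: \<tau>'_def \<pi>_def \<sigma>'_def split: sum.split)
      then have "sat G r \<tau>' \<psi>"
        using P_iff[OF y(1)] y(2) by (simp add: \<psi>(2))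
      moreover have "sat G r \<tau> \<psi> = sat G r \<tau>' \<psi>"
        by (rule sat_cong_fv) (auto simp: \<tau>_def \<tau>'_def xs)
      ultimately show ?R
        using y(1) by (intro exI[of _ \<tau>]) (auto simp: \<tau>_def)
    next
      assume ?R
      then obtain \<tau> where \<tau>: "\<forall>x. x \<notin> set xs \<longrightarrow> \<tau> x = \<sigma>' x" "\<forall>x\<in>set xs. \<tau> x \<in> verts G"
        "sat G r \<tau> \<psi>" by blast
      \<comment> \<open>Odd variables that are not quantified keep their value under
        \<open>\<sigma>'\<close>, which is a vertex as well.\<close>
      define y where "y k = \<tau> (2 * k + 1)" for k
      have "\<sigma>' x \<in> verts G" for x
        using \<sigma> by (auto simp: \<sigma>'_def)
      then have "\<tau> x \<in> verts G" for x
        using \<tau>(1,2) by metis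
      then have y: "range y \<subseteq> verts G"
        by (auto simp: y_def)
      have even: "\<tau> (2 * b) = \<sigma>' (2 * b)" for b
        using \<tau>(1) by (simp add: xs)
      have "\<tau> (\<pi> a) = case_sum \<sigma> y (from_nat a)" for a
        using even by (auto simp: \<pi>_def y_def \<sigma>'_def split: sum.split)
      then have "sat G r (\<lambda>a. case_sum \<sigma> y (from_nat a)) \<phi>"
        using \<tau>(3) unfolding \<psi>(2) by simp
      with P_iff[OF y] y show ?L by blast
    qed
    then show "(\<exists>y. range y \<subseteq> verts G \<and> P G r \<sigma> y) = sat G r (\<lambda>a. \<sigma> (from_nat a)) \<chi>"
      by (simp add: \<chi>(2) sat_foldr_Exists \<sigma>'_def)
  qed
qed

lemma definable_all:
  fixes P :: "'v lgraph \<Rightarrow> ('v \<times> 'v) set \<Rightarrow> ('i::countable \<Rightarrow> 'v) \<Rightarrow> (nat \<Rightarrow> 'v) \<Rightarrow> bool"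
  assumes "definable n (\<lambda>G r \<tau>. P G r (\<lambda>i. \<tau> (Inl i)) (\<lambda>k. \<tau> (Inr k)))"
  shows "definable n (\<lambda>G r \<sigma>. \<forall>y. range y \<subseteq> verts G \<longrightarrow> P G r \<sigma> y)"
  by (rule definable_cong[OF definable_not[OF definable_ex[OF definable_not[OF assms]]]]) blast

text \<open>All free variables are collapsed to \<open>0\<close>, because a unary formula is
  evaluated under a constant assignment.\<close>

lemma unary_formula_of_definable:
  fixes P :: "'v lgraph \<Rightarrow> ('v \<times> 'v) set \<Rightarrow> 'v \<Rightarrow> bool"
  assumes "definable n (\<lambda>G r (\<sigma> :: nat \<Rightarrow> 'v). P G r (\<sigma> 0))"
  obtains \<phi> where "unary_formula n \<phi>"
    and "\<And>G r u. is_graph n G \<Longrightarrow> r \<in> vertex_orders G \<Longrightarrow> u \<in> verts G \<Longrightarrow>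
      sat G r (\<lambda>_. u) \<phi> = P G r u"
  using assms
proof (rule definableE)
  fix \<phi>
  assume \<phi>: "props \<phi> \<subseteq> {..<n}"
    "\<And>G r \<sigma>. is_graph n G \<Longrightarrow> r \<in> vertex_orders G \<Longrightarrow> range \<sigma> \<subseteq> verts G \<Longrightarrow>
      P G r (\<sigma> 0) = sat G r (\<lambda>a. \<sigma> (from_nat a)) \<phi>"
  obtain \<psi> where \<psi>: "fv \<psi> \<subseteq> (\<lambda>_. 0) ` fv \<phi>" "props \<psi> = props \<phi>"
    "\<And>(G :: 'v lgraph) r \<sigma>. sat G r \<sigma> \<psi> = sat G r (\<lambda>_. \<sigma> 0) \<phi>"
    using ex_renaming[of "\<lambda>_. 0" \<phi>] by blast
  show ?thesis
  proof (rule that)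
    \<comment> \<open>The trivial equation makes \<open>0\<close> occur free even when
      \<open>\<psi>\<close> is a sentence.\<close>
    show "unary_formula n (Conj (EqAt 0 0) \<psi>)"
      using \<phi>(1) \<psi>(1,2) by (auto simp: unary_formula_def)
    show "sat G r (\<lambda>_. u) (Conj (EqAt 0 0) \<psi>) = P G r u"
      if "is_graph n G" "r \<in> vertex_orders G" "u \<in> verts G" for G r u
      using \<phi>(2)[of G r "\<lambda>_. u"] that by (simp add: \<psi>(3))
  qed
qed

lemma definable_label:
  fixes z :: "'i::countable"
  assumes "length l = n"
  shows "definable n (\<lambda>G r (\<sigma> :: 'i \<Rightarrow> 'v). lab G (\<sigma> z) = l)"
proof -
  have "definable n (\<lambda>G r (\<sigma> :: 'i \<Rightarrow> 'v). \<forall>p\<in>{..<n}. lab G (\<sigma> z) ! p \<longleftrightarrow> l ! p)"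
    by (intro definable_ball definable_iff definable_prop definable_const) auto
  then show ?thesis
  proof (rule definable_cong)
    fix G :: "'v lgraph" and r and \<sigma> :: "'i \<Rightarrow> 'v"
    assume "is_graph n G" "range \<sigma> \<subseteq> verts G"
    then have "length (lab G (\<sigma> z)) = n"
      by (auto simp: is_graph_def)
    then show "lab G (\<sigma> z) = l \<longleftrightarrow> (\<forall>p\<in>{..<n}. lab G (\<sigma> z) ! p \<longleftrightarrow> l ! p)"
      using assms by (simp add: list_eq_iff_nth_eq Ball_def)
  qed
qed

section \<open>Keys with order-uniform behaviour\<close>

text \<open>Arguments are infinite sequences and the arity is merely some bound, so terms with
  different numbers of arguments share a type and combine by reindexing.\<close>

definition finitary :: "((nat \<Rightarrow> 'a) \<Rightarrow> 'b) \<Rightarrow> bool" where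
  "finitary f \<longleftrightarrow> (\<exists>m. \<forall>x y. (\<forall>k<m. x k = y k) \<longrightarrow> f x = f y)"

text \<open>Comparing each pair in both directions also records ties. Ties occur, since one vertex
  can fill several argument places.\<close>

definition same_order_type :: "nat \<Rightarrow> (nat \<Rightarrow> nat) \<Rightarrow> (nat \<Rightarrow> nat) \<Rightarrow> bool" where
  "same_order_type m a b \<longleftrightarrow> (\<forall>i<m. \<forall>j<m. a i < a j \<longleftrightarrow> b i < b j)"

definition order_uniform :: "(nat \<Rightarrow> 'a) \<Rightarrow> ((nat \<Rightarrow> 'a) \<Rightarrow> bool) \<Rightarrow> bool" where
  "order_uniform s R \<longleftrightarrow>
     (\<exists>m. \<forall>a b. same_order_type m a b \<longrightarrow> R (\<lambda>i. s (a i)) = R (\<lambda>i. s (b i)))"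

section \<open>Order types and Ramsey's theorem\<close>

lemma finitary_common_bound:
  assumes "finite F" and "\<And>f. f \<in> F \<Longrightarrow> finitary f"
  obtains m where "\<And>f x y. f \<in> F \<Longrightarrow> (\<And>k. k < m \<Longrightarrow> x k = y k) \<Longrightarrow> f x = f y"
proof -
  have "\<exists>m. \<forall>f\<in>F. \<forall>x y. (\<forall>k<m. x k = y k) \<longrightarrow> f x = f y"
    using assms
  proof (induction F rule: finite_induct)
    case empty
    show ?case by simp
  next
    case (insert f F)
    obtain m1 where m1: "\<forall>x y. (\<forall>k<m1. x k = y k) \<longrightarrow> f x = f y"
      using insert.prems[of f] unfolding finitary_def by blast
    obtain m2 where m2: "\<forall>f\<in>F. \<forall>x y. (\<forall>k<m2. x k = y k) \<longrightarrow> f x = f y"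
      using insert by blast
    from m1 m2 show ?case
      by (intro exI[of _ "max m1 m2"]) auto
  qed
  then obtain m where m: "\<forall>f\<in>F. \<forall>x y. (\<forall>k<m. x k = y k) \<longrightarrow> f x = f y"
    by blast
  show thesis by (rule that[of m]) (use m in blast)
qed

lemma enumerate_card_less:
  fixes X :: "nat set"
  assumes "finite X" and "v \<in> X"
  shows "enumerate X (card {y \<in> X. y < v}) = v"
proof -
  obtain k where k: "k < card X" "enumerate X k = v"
    using finite_enumerate_Ex[OF assms] by blast
  have "{y \<in> X. y < v} = enumerate X ` {..<k}"
  proof (intro equalityI subsetI)
    fix y
    assume "y \<in> {y \<in> X. y < v}"
    moreover from this obtain l where "l < card X" "enumerate X l = y"
      using finite_enumerate_Ex[OF assms(1), of y] by blast
    ultimately show "y \<in> enumerate X ` {..<k}"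
      using k assms(1) by (auto simp: image_iff intro!: bexI[of _ l])
  next
    fix y
    assume "y \<in> enumerate X ` {..<k}"
    then show "y \<in> {y \<in> X. y < v}"
      using k assms(1) by (auto simp: finite_enumerate_in_set)
  qed
  moreover have "inj_on (enumerate X) {..<k}"
    by (intro inj_onI) (metis assms(1) finite_enumerate_mono_iff k(1) lessThan_iff less_irrefl
        linorder_neqE_nat order.strict_trans)
  ultimately show ?thesis
    using k by (simp add: card_image)
qed

text \<open>
  The position of \<open>a i\<close> among the values of \<open>a\<close>, counted through first occurrences so that it
  visibly depends on the order type of \<open>a\<close> only.
\<close>

definition position :: "nat \<Rightarrow> (nat \<Rightarrow> nat) \<Rightarrow> nat \<Rightarrow> nat" where
  "position m a i = card {j. j < m \<and> a j < a i \<and> (\<forall>j'<j. a j' < a j \<or> a j < a j')}"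

lemma position_cong:
  assumes "same_order_type m a b" and "i < m"
  shows "position m a i = position m b i"
proof -
  have "(a j < a i \<and> (\<forall>j'<j. a j' < a j \<or> a j < a j')) \<longleftrightarrow>
      (b j < b i \<and> (\<forall>j'<j. b j' < b j \<or> b j < b j'))" if "j < m" for j
    using assms that unfolding same_order_type_def by (meson order.strict_trans)
  then show ?thesis
    unfolding position_def by (intro arg_cong[of _ _ card]) blast
qed

lemma position_less:
  assumes "i < m"
  shows "position m a i < m"
proof -
  have "{j. j < m \<and> a j < a i \<and> (\<forall>j'<j. a j' < a j \<or> a j < a j')} \<subset> {..<m}"
    using assms by auto
  from psubset_card_mono[OF _ this] show ?thesis
    by (simp add: position_def)
qed

lemma position_eq_card: "position m a i = card {y \<in> a ` {..<m}. y < a i}"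
proof -
  let ?J = "{j. j < m \<and> a j < a i \<and> (\<forall>j'<j. a j' < a j \<or> a j < a j')}"
  have "inj_on a ?J"
    by (intro inj_onI) (metis (mono_tags, lifting) less_irrefl linorder_neqE_nat mem_Collect_eq)
  moreover have "a ` ?J = {y \<in> a ` {..<m}. y < a i}"
  proof (intro equalityI subsetI)
    fix y
    assume "y \<in> {y \<in> a ` {..<m}. y < a i}"
    then obtain j where j: "j < m" "a j = y" "y < a i" by auto
    define l where "l = (LEAST l. a l = y)"
    have "a l = y" "l \<le> j"
      using j(2) unfolding l_def by (auto intro: LeastI Least_le)
    moreover have "a j' \<noteq> y" if "j' < l" for j'
      using that not_less_Least unfolding l_def by blast
    ultimately have "l \<in> ?J"
      using j by (auto simp: nat_neq_iff)
    with \<open>a l = y\<close> show "y \<in> a ` ?J" by blast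
  qed auto
  ultimately show ?thesis
    unfolding position_def using card_image[of a ?J] by simp
qed

text \<open>An \<open>m\<close>-element set is coloured by all pairs of a relation and a pattern
  that hold on it, so one colour settles every relation under every arrangement. On a homogeneous
  set \<open>Y\<close> truth depends on the pattern alone, and the pattern of a tuple is determined
  by its order type. The sequence \<open>s\<close> lists \<open>Y\<close> in increasing
  order.\<close>

lemma ramsey_order_uniform:
  fixes \<R> :: "((nat \<Rightarrow> real) \<Rightarrow> bool) set"
  assumes "finite \<R>" and "\<And>R. R \<in> \<R> \<Longrightarrow> finitary R"
  obtains s :: "nat \<Rightarrow> real" where "inj s" and "\<And>R. R \<in> \<R> \<Longrightarrow> order_uniform s R"
proof -
  obtain m where m: "\<And>R x y. R \<in> \<R> \<Longrightarrow> (\<And>k. k < m \<Longrightarrow> x k = y k) \<Longrightarrow> R x = R y"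
    using finitary_common_bound[OF assms] by blast
  \<comment> \<open>A pattern says which element of an \<open>m\<close>-set fills which argument
    place. Patterns need not be injective, which covers tuples with repetitions.\<close>
  define C where "C = {..<m} \<rightarrow>\<^sub>E {..<m}"
  define colour where
    "colour X = {(R, c) \<in> \<R> \<times> C. R (\<lambda>i. real (enumerate X (c i)))}" for X :: "nat set"
  have "finite (\<R> \<times> C)"
    unfolding C_def using assms(1) by (simp add: finite_PiE)
  \<comment> \<open>\<open>Ramsey\<close> takes numbers below a bound as colours, hence the
    injective coding \<open>h\<close>.\<close>
  then obtain h :: "_ \<Rightarrow> nat" and t where h: "h ` Pow (\<R> \<times> C) = {i. i < t}" "inj_on h (Pow (\<R> \<times> C))"
    using finite_imp_inj_to_nat_seg[of "Pow (\<R> \<times> C)"] by auto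
  have colour_in: "colour X \<in> Pow (\<R> \<times> C)" for X
    by (auto simp: colour_def)
  then have "\<forall>X. X \<subseteq> UNIV \<and> finite X \<and> card X = m \<longrightarrow> h (colour X) < t"
    using h(1) by blast
  from Ramsey[OF infinite_UNIV_nat this] obtain Y t' where Y: "infinite Y"
    "\<forall>X. X \<subseteq> Y \<and> finite X \<and> card X = m \<longrightarrow> h (colour X) = t'"
    by auto
  have homogeneous: "colour X = colour X'"
    if "X \<subseteq> Y" "finite X" "card X = m" "X' \<subseteq> Y" "finite X'" "card X' = m" for X X'
    using Y(2) that inj_onD[OF h(2) _ colour_in colour_in] by simp
  define s where "s k = real (enumerate Y k)" for k
  \<comment> \<open>Homogeneity concerns sets of exactly \<open>m\<close> elements, while a tuple
    may have fewer distinct values. It is padded with larger elements of \<open>Y\<close>, which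
    leaves the positions of its own entries unchanged.\<close>
  have cover: "\<exists>X. X \<subseteq> Y \<and> finite X \<and> card X = m \<and>
      (\<forall>i<m. enumerate X (position m a i) = enumerate Y (a i))" for a
  proof -
    define A where "A = a ` {..<m}"
    have A: "finite A" "card A \<le> m"
      unfolding A_def using card_image_le[of "{..<m}" a] by auto
    obtain M where M: "\<And>x. x \<in> A \<Longrightarrow> x < M"
      using finite_nat_set_iff_bounded A(1) by auto
    define B where "B = A \<union> {M..<M + (m - card A)}"
    have "A \<inter> {M..<M + (m - card A)} = {}"
      using M by fastforce
    then have B: "finite B" "card B = m"
      unfolding B_def using A by (simp_all add: card_Un_disjoint)
    define X where "X = enumerate Y ` B"
    have inj: "inj (enumerate Y)"
      using strict_mono_imp_inj_on[OF strict_mono_enumerate[OF Y(1)]] .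
    have "X \<subseteq> Y" "finite X" "card X = m"
      using B Y(1) inj by (auto simp: X_def enumerate_in_set card_image inj_on_subset)
    moreover have "enumerate X (position m a i) = enumerate Y (a i)" if "i < m" for i
    proof -
      have "a i \<in> A" using that by (auto simp: A_def)
      have "{y \<in> X. y < enumerate Y (a i)} = enumerate Y ` {y \<in> B. y < a i}"
        unfolding X_def using Y(1) by auto
      also have "{y \<in> B. y < a i} = {y \<in> A. y < a i}"
        using M[OF \<open>a i \<in> A\<close>] by (auto simp: B_def)
      finally have "card {y \<in> X. y < enumerate Y (a i)} = position m a i"
        using inj by (simp add: card_image inj_on_subset position_eq_card A_def)
      moreover have "enumerate Y (a i) \<in> X"
        using \<open>a i \<in> A\<close> by (auto simp: X_def B_def)
      ultimately show ?thesis
        using enumerate_card_less[OF \<open>finite X\<close>] by metis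
    qed
    ultimately show ?thesis by blast
  qed
  show thesis
  proof (rule that[of s])
    show "inj s"
      using strict_mono_imp_inj_on[OF strict_mono_enumerate[OF Y(1)]]
      by (auto simp: s_def inj_on_def)
    fix R
    assume R: "R \<in> \<R>"
    have via_colour: "R (\<lambda>i. s (a i)) \<longleftrightarrow> (R, restrict (position m a) {..<m}) \<in> colour X"
      if "\<forall>i<m. enumerate X (position m a i) = enumerate Y (a i)" for a X
    proof -
      have "restrict (position m a) {..<m} \<in> C"
        by (auto simp: C_def position_less)
      moreover have "R (\<lambda>i. s (a i)) = R (\<lambda>i. real (enumerate X (restrict (position m a) {..<m} i)))"
        by (rule m[OF R]) (use that in \<open>simp add: s_def\<close>)
      ultimately show ?thesis
        using R by (simp add: colour_def)
    qed
    have "R (\<lambda>i. s (a i)) = R (\<lambda>i. s (b i))" if "same_order_type m a b" for a b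
    proof -
      obtain X where X: "X \<subseteq> Y" "finite X" "card X = m"
        "\<forall>i<m. enumerate X (position m a i) = enumerate Y (a i)"
        using cover by blast
      obtain X' where X': "X' \<subseteq> Y" "finite X'" "card X' = m"
        "\<forall>i<m. enumerate X' (position m b i) = enumerate Y (b i)"
        using cover by blast
      have "restrict (position m a) {..<m} = restrict (position m b) {..<m}"
        using position_cong[OF that] by (auto simp: restrict_def)
      then show ?thesis
        using via_colour[OF X(4)] via_colour[OF X'(4)] homogeneous[OF X(1-3) X'(1-3)] by simp
    qed
    then show "order_uniform s R"
      unfolding order_uniform_def by blast
  qed
qed

section \<open>Keys assigned along a vertex order\<close>

definition key_of :: "(nat \<Rightarrow> real) \<Rightarrow> ('v \<times> 'v) set \<Rightarrow> 'v \<Rightarrow> real" where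
  "key_of s r v = s (card {w. (w, v) \<in> r})"

text \<open>Along an edge of \<open>r\<close> the predecessor sets grow by transitivity, strictly so
  by irreflexivity; totality gives the converse. Ranks are the indices that
  \<open>order_uniform\<close> compares, so their comparison becomes the atom for
  \<open><\<close>.\<close>

lemma card_predecessors_less_iff:
  assumes "is_graph n G" and "r \<in> vertex_orders G" and "v \<in> verts G" and "w \<in> verts G"
  shows "card {x. (x, v) \<in> r} < card {x. (x, w) \<in> r} \<longleftrightarrow> (v, w) \<in> r"
proof -
  have r: "r \<subseteq> verts G \<times> verts G" "trans r" "irrefl r" "total_on (verts G) r"
    using assms(2) by (auto simp: vertex_orders_def strict_linear_order_on_def)
  have fin: "finite {x. (x, z) \<in> r}" for z
    using r(1) assms(1) by (auto simp: is_graph_def intro: finite_subset[of _ "verts G"])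
  have mono: "card {x. (x, a) \<in> r} < card {x. (x, b) \<in> r}" if "(a, b) \<in> r" for a b
  proof (rule psubset_card_mono[OF fin])
    have "a \<notin> {x. (x, a) \<in> r}" using r(3) by (auto simp: irrefl_def)
    then show "{x. (x, a) \<in> r} \<subset> {x. (x, b) \<in> r}"
      using that r(2) by (auto dest: transD)
  qed
  show ?thesis
  proof
    assume less: "card {x. (x, v) \<in> r} < card {x. (x, w) \<in> r}"
    then have "v \<noteq> w" by auto
    then have "(v, w) \<in> r \<or> (w, v) \<in> r"
      using r(4) assms(3,4) by (auto simp: total_on_def)
    then show "(v, w) \<in> r"
      using mono[of w v] less by auto
  qed (rule mono)
qed

lemma key_of_in_keyings:
  assumes "is_graph n G" and "r \<in> vertex_orders G" and "inj s"
  shows "key_of s r \<in> keyings G"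
proof -
  have "total_on (verts G) r"
    using assms(2) by (auto simp: vertex_orders_def strict_linear_order_on_def)
  then have "v = w" if "v \<in> verts G" "w \<in> verts G" "key_of s r v = key_of s r w" for v w
    using that card_predecessors_less_iff[OF assms(1,2), of v w]
      card_predecessors_less_iff[OF assms(1,2), of w v] injD[OF assms(3)]
    by (fastforce simp: key_of_def total_on_def)
  then show ?thesis
    by (auto simp: keyings_def inj_on_def)
qed

text \<open>Index tuples of length \<open>m\<close> have finitely many order types, so
  \<open>R\<close> is a finite disjunction of descriptions by \<open><\<close>.\<close>

lemma definable_order_uniform:
  fixes \<rho> :: "nat \<Rightarrow> 'i::countable"
  assumes "order_uniform s R"
  shows "definable n (\<lambda>G r (\<sigma> :: 'i \<Rightarrow> 'v). R (\<lambda>k. key_of s r (\<sigma> (\<rho> k))))"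
proof -
  obtain m where m: "\<And>a b. same_order_type m a b \<Longrightarrow> R (\<lambda>i. s (a i)) = R (\<lambda>i. s (b i))"
    using assms unfolding order_uniform_def by blast
  define I where "I = {..<m} \<times> {..<m}"
  define type where "type a = {p \<in> I. a (fst p) < a (snd p)}" for a :: "nat \<Rightarrow> nat"
  \<comment> \<open>A type is good as soon as one tuple of that type satisfies \<open>R\<close>;
    uniformity extends this to all tuples of the type.\<close>
  define good where "good = type ` {a. R (\<lambda>i. s (a i))}"
  have "finite I" by (simp add: I_def)
  moreover have "good \<subseteq> Pow I" by (auto simp: good_def type_def)
  ultimately have "finite good" by (meson finite_Pow_iff finite_subset)
  have "R (\<lambda>i. s (a i)) \<longleftrightarrow> type a \<in> good" for a
  proof
    assume "type a \<in> good"
    then obtain b where b: "type a = type b" "R (\<lambda>i. s (b i))"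
      by (auto simp: good_def)
    then have "(i, j) \<in> type a \<longleftrightarrow> (i, j) \<in> type b" for i j by simp
    then have "same_order_type m a b"
      by (auto simp: same_order_type_def type_def I_def)
    with b(2) m show "R (\<lambda>i. s (a i))" by blast
  qed (auto simp: good_def)
  also have "type a \<in> good \<longleftrightarrow> (\<exists>t\<in>good. \<forall>p\<in>I. a (fst p) < a (snd p) \<longleftrightarrow> p \<in> t)" for a
  proof -
    have "type a = t \<longleftrightarrow> (\<forall>p\<in>I. a (fst p) < a (snd p) \<longleftrightarrow> p \<in> t)" if "t \<subseteq> I" for t
      using that unfolding type_def by blast
    moreover have "t \<subseteq> I" if "t \<in> good" for t
      using that \<open>good \<subseteq> Pow I\<close> by auto
    ultimately have "(\<exists>t\<in>good. type a = t) \<longleftrightarrow>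
        (\<exists>t\<in>good. \<forall>p\<in>I. a (fst p) < a (snd p) \<longleftrightarrow> p \<in> t)"
      by (intro bex_cong refl) metis
    then show ?thesis by simp
  qed
  finally have R_iff: "R (\<lambda>i. s (a i)) \<longleftrightarrow> (\<exists>t\<in>good. \<forall>p\<in>I. a (fst p) < a (snd p) \<longleftrightarrow> p \<in> t)" for a .
  have "definable n (\<lambda>G r (\<sigma> :: 'i \<Rightarrow> 'v).
      \<exists>t\<in>good. \<forall>p\<in>I. (\<sigma> (\<rho> (fst p)), \<sigma> (\<rho> (snd p))) \<in> r \<longleftrightarrow> p \<in> t)"
    by (intro definable_bex definable_ball definable_iff definable_less definable_const
        \<open>finite good\<close> \<open>finite I\<close>)
  then show ?thesis
    by (rule definable_cong) (simp add: key_of_def R_iff card_predecessors_less_iff image_subset_iff)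
qed

section \<open>Embeddings as terms over finitely many keys\<close>

definition embed :: "gnn \<Rightarrow> 'v lgraph \<Rightarrow> ('v \<Rightarrow> real) \<Rightarrow> nat \<Rightarrow> 'v \<Rightarrow> real list" where
  "embed N G key i = fold (apply_layer G) (take i (layers N)) (initial_emb G key)"

lemma embed_0: "embed N G key 0 = initial_emb G key"
  by (simp add: embed_def)

lemma embed_Suc:
  "i < length (layers N) \<Longrightarrow>
     embed N G key (Suc i) = apply_layer G (layers N ! i) (embed N G key i)"
  by (simp add: embed_def take_Suc_conv_app_nth)

definition nbrs :: "'v lgraph \<Rightarrow> 'v \<Rightarrow> 'v set" where
  "nbrs G u = {v. (u, v) \<in> edges G}"

definition nbr_max :: "'v lgraph \<Rightarrow> ('v \<Rightarrow> real list) \<Rightarrow> nat \<Rightarrow> 'v \<Rightarrow> real" where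
  "nbr_max G e j u = (if nbrs G u = {} then 0 else Max ((\<lambda>v. e v ! j) ` nbrs G u))"

lemma nbrs_subset: "is_graph n G \<Longrightarrow> nbrs G u \<subseteq> verts G"
  by (auto simp: is_graph_def nbrs_def)

lemma finite_nbrs: "is_graph n G \<Longrightarrow> finite (nbrs G u)"
  by (rule finite_subset[OF nbrs_subset[of n]]) (simp_all add: is_graph_def)

text \<open>Dimensions must be tracked because \<open>local_max\<close> fixes \<open>agg\<close>
  only on multisets of vectors of the right length.\<close>

lemma embed_in_vec:
  assumes "is_gnn n N" and "is_graph n G" and "i \<le> length (layers N)" and "u \<in> verts G"
  shows "embed N G key i u \<in> vec (dims N ! i)"
  using assms(3,4)
proof (induction i arbitrary: u)
  case 0
  have "dims N ! 0 = n + 1"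
    using assms(1) by (cases "dims N") (auto simp: is_gnn_def)
  with 0 assms(2) show ?case
    by (simp add: embed_0 initial_emb_def vec_def is_graph_def)
next
  case (Suc i)
  then have i: "i < length (layers N)" by simp
  let ?M = "image_mset (embed N G key i) (mset_set {v. (u, v) \<in> edges G})"
  have "set_mset ?M \<subseteq> vec (dims N ! i)"
    using finite_nbrs[OF assms(2), of u] nbrs_subset[OF assms(2), of u] Suc.IH i
    by (auto simp: nbrs_def)
  then have "agg (layers N ! i) ?M \<in> vec (dims N ! i)"
    using assms(1) i by (auto simp: is_gnn_def)
  moreover have "embed N G key i u \<in> vec (dims N ! i)"
    using Suc.IH Suc.prems by simp
  ultimately have "embed N G key i u @ agg (layers N ! i) ?M \<in> vec (2 * dims N ! i)"
    by (simp add: vec_def)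
  then show ?case
    using assms(1) i by (auto simp: is_gnn_def embed_Suc apply_layer_def)
qed

lemma embed_Suc_local_max:
  assumes "is_gnn n N" and "local_max N" and "is_graph n G"
    and "i < length (layers N)" and "u \<in> verts G"
  shows "embed N G key (Suc i) u =
    com (layers N ! i) (embed N G key i u @
      map (\<lambda>j. nbr_max G (embed N G key i) j u) [0..<dims N ! i])"
proof -
  let ?M = "image_mset (embed N G key i) (mset_set (nbrs G u))"
  have fin: "finite (nbrs G u)" by (rule finite_nbrs[OF assms(3)])
  have "set_mset ?M \<subseteq> vec (dims N ! i)"
    using fin nbrs_subset[OF assms(3), of u] embed_in_vec[OF assms(1,3), of i] assms(4)
    by auto
  then have "agg (layers N ! i) ?M = coord_max (dims N ! i) ?M"
    using assms(2,4) by (auto simp: local_max_def)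
  also have "\<dots> = map (\<lambda>j. nbr_max G (embed N G key i) j u) [0..<dims N ! i]"
    using fin by (auto simp: coord_max_def nbr_max_def image_image map_replicate_const mset_set_empty_iff)
  finally show ?thesis
    by (simp add: embed_Suc[OF assms(4)] apply_layer_def nbrs_def)
qed

section \<open>Terms that name embeddings\<close>

text \<open>\<open>prod_encode\<close> cuts the argument sequence into independent blocks: block
  \<open>0\<close> feeds the term of the vertex itself, block \<open>Suc j\<close> the term
  supplying coordinate \<open>j\<close> of the maximum. Coordinates get separate blocks since they
  can be maximal at different neighbours.\<close>

definition layer_term ::
  "layer \<Rightarrow> nat \<Rightarrow> ((nat \<Rightarrow> real) \<Rightarrow> real list) \<Rightarrow> (nat \<Rightarrow> (nat \<Rightarrow> real) \<Rightarrow> real list) \<Rightarrow>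
     (nat \<Rightarrow> real) \<Rightarrow> real list" where
  "layer_term L d f g x =
     com L (f (\<lambda>k. x (prod_encode (0, k))) @
       map (\<lambda>j. g j (\<lambda>k. x (prod_encode (Suc j, k))) ! j) [0..<d])"

text \<open>
  Each coordinate of a neighbourhood maximum is attained at some neighbour, so every embedding is
  the value of one of finitely many functions at the keys of boundedly many vertices. The constant
  zero vector supplies the maximum over an empty neighbourhood.
\<close>

fun emb_terms :: "nat \<Rightarrow> gnn \<Rightarrow> nat \<Rightarrow> ((nat \<Rightarrow> real) \<Rightarrow> real list) set" where
  "emb_terms n N 0 =
     insert (\<lambda>_. replicate (dims N ! 0) 0) ((\<lambda>l x. map of_bool l @ [x 0]) ` {l. length l = n})"
| "emb_terms n N (Suc i) =
     insert (\<lambda>_. replicate (dims N ! Suc i) 0)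
       ((\<lambda>(f, g). layer_term (layers N ! i) (dims N ! i) f g) `
         (emb_terms n N i \<times> ({..<dims N ! i} \<rightarrow>\<^sub>E emb_terms n N i)))"

lemma finite_bool_lists: "finite {l :: bool list. length l = n}"
  using finite_lists_length_eq[of "UNIV :: bool set" n] by simp

lemma finite_emb_terms: "finite (emb_terms n N i)"
  by (induction i) (auto simp: finite_bool_lists intro!: finite_PiE)

lemma zero_in_emb_terms: "(\<lambda>_. replicate (dims N ! i) 0) \<in> emb_terms n N i"
  by (cases i) auto

lemma layer_term_in_emb_terms:
  "f \<in> emb_terms n N i \<Longrightarrow> g \<in> {..<dims N ! i} \<rightarrow>\<^sub>E emb_terms n N i \<Longrightarrow>
     layer_term (layers N ! i) (dims N ! i) f g \<in> emb_terms n N (Suc i)"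
  by auto

lemma finitary_reindex:
  assumes "finitary f"
  shows "finitary (\<lambda>x. f (\<lambda>k. x (\<rho> k)))"
proof -
  obtain m where m: "\<And>x y. (\<forall>k<m. x k = y k) \<Longrightarrow> f x = f y"
    using assms unfolding finitary_def by blast
  obtain m' where "\<forall>k\<in>\<rho> ` {..<m}. k < m'"
    using finite_nat_set_iff_bounded[of "\<rho> ` {..<m}"] by auto
  then have "\<forall>x y. (\<forall>k<m'. x k = y k) \<longrightarrow> f (\<lambda>k. x (\<rho> k)) = f (\<lambda>k. y (\<rho> k))"
    by (auto intro!: m)
  then show ?thesis unfolding finitary_def by blast
qed

lemma finitary_compose: "finitary f \<Longrightarrow> finitary (\<lambda>x. h (f x))"
  unfolding finitary_def by metis

lemma finitary_compose2:
  assumes "finitary f" and "finitary g"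
  shows "finitary (\<lambda>x. h (f x) (g x))"
proof -
  obtain m1 m2 where "\<forall>x y. (\<forall>k<m1. x k = y k) \<longrightarrow> f x = f y"
    "\<forall>x y. (\<forall>k<m2. x k = y k) \<longrightarrow> g x = g y"
    using assms unfolding finitary_def by blast
  then have "\<forall>x y. (\<forall>k<max m1 m2. x k = y k) \<longrightarrow> h (f x) (g x) = h (f y) (g y)"
    by (metis less_max_iff_disj)
  then show ?thesis unfolding finitary_def by blast
qed

lemma finitary_map:
  assumes "\<And>j. j < d \<Longrightarrow> finitary (F j)"
  shows "finitary (\<lambda>x. map (\<lambda>j. F j x) [0..<d])"
  using assms
proof (induction d)
  case 0
  show ?case by (simp add: finitary_def)
next
  case (Suc d)
  have "finitary (\<lambda>x. map (\<lambda>j. F j x) [0..<d] @ [F d x])"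
    using Suc by (intro finitary_compose2[where h = "\<lambda>xs y. xs @ [y]"]) auto
  then show ?case by simp
qed

lemma finitary_emb_terms: "f \<in> emb_terms n N i \<Longrightarrow> finitary f"
proof (induction i arbitrary: f)
  case 0
  then consider "f = (\<lambda>_. replicate (dims N ! 0) 0)"
    | l where "f = (\<lambda>x. map of_bool l @ [x 0])"
    by auto
  then show ?case
    by cases (auto simp: finitary_def)
next
  case (Suc i)
  then consider "f = (\<lambda>_. replicate (dims N ! Suc i) 0)"
    | g h where "f = layer_term (layers N ! i) (dims N ! i) g h" "g \<in> emb_terms n N i"
      "h \<in> {..<dims N ! i} \<rightarrow>\<^sub>E emb_terms n N i"
    by auto
  then show ?case
  proof cases
    case 1
    then show ?thesis by (simp add: finitary_def)
  next
    case 2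
    have "finitary (\<lambda>x. map (\<lambda>j. h j (\<lambda>k. x (prod_encode (Suc j, k))) ! j) [0..<dims N ! i])"
    proof (rule finitary_map)
      fix j
      assume "j < dims N ! i"
      then have "finitary (h j)" using 2(3) Suc.IH by auto
      from finitary_compose[OF finitary_reindex[OF this], of "\<lambda>v. v ! j"]
      show "finitary (\<lambda>x. h j (\<lambda>k. x (prod_encode (Suc j, k))) ! j)" .
    qed
    from finitary_compose2[OF finitary_reindex[OF Suc.IH[OF 2(2)]] this,
        of "\<lambda>a b. com (layers N ! i) (a @ b)" "\<lambda>k. prod_encode (0, k)"]
    show ?thesis
      unfolding 2(1) layer_term_def[abs_def] .
  qed
qed

text \<open>One sequence \<open>x\<close> serves all blocks of \<open>layer_term\<close>. A maximum
  is only required to have the value of a term; whether the vertices used are neighbours is left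
  open, so empty neighbourhoods fit in.\<close>

definition layer_witness ::
  "gnn \<Rightarrow> 'v lgraph \<Rightarrow> ('v \<Rightarrow> real) \<Rightarrow> nat \<Rightarrow> 'v \<Rightarrow> ((nat \<Rightarrow> real) \<Rightarrow> real list) \<Rightarrow>
     (nat \<Rightarrow> (nat \<Rightarrow> real) \<Rightarrow> real list) \<Rightarrow> (nat \<Rightarrow> 'v) \<Rightarrow> bool" where
  "layer_witness N G key i u f g x \<longleftrightarrow>
     embed N G key i u = f (\<lambda>k. key (x (prod_encode (0, k)))) \<and>
     (\<forall>j\<in>{..<dims N ! i}.
        nbr_max G (embed N G key i) j u = g j (\<lambda>k. key (x (prod_encode (Suc j, k)))) ! j)"

lemma embed_Suc_layer_witness:
  assumes "is_gnn n N" and "local_max N" and "is_graph n G"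
    and "i < length (layers N)" and "u \<in> verts G" and "layer_witness N G key i u f g x"
  shows "embed N G key (Suc i) u = layer_term (layers N ! i) (dims N ! i) f g (\<lambda>k. key (x k))"
  using assms(6) unfolding embed_Suc_local_max[OF assms(1-5)] layer_term_def layer_witness_def
  by (auto intro!: arg_cong[of _ _ "com (layers N ! i)"])

text \<open>A coordinate of the maximum is attained at some neighbour, whose name serves for that
  coordinate; the names chosen per coordinate are then merged into one sequence.\<close>

lemma ex_layer_witness:
  assumes "is_graph n G" and u: "u \<in> verts G"
    and terms: "\<And>v. v \<in> verts G \<Longrightarrow>
      \<exists>f\<in>emb_terms n N i. \<exists>y. range y \<subseteq> verts G \<and> embed N G key i v = f (\<lambda>k. key (y k))"
  shows "\<exists>f\<in>emb_terms n N i. \<exists>g\<in>{..<dims N ! i} \<rightarrow>\<^sub>E emb_terms n N i. \<exists>x.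
    range x \<subseteq> verts G \<and> layer_witness N G key i u f g x"
proof -
  have "\<exists>f\<in>emb_terms n N i. \<exists>y. range y \<subseteq> verts G \<and>
      nbr_max G (embed N G key i) j u = f (\<lambda>k. key (y k)) ! j" if "j < dims N ! i" for j
  proof (cases "nbrs G u = {}")
    case True
    with that u show ?thesis
      by (intro bexI[OF _ zero_in_emb_terms] exI[of _ "\<lambda>_. u"]) (auto simp: nbr_max_def)
  next
    case False
    let ?A = "(\<lambda>v. embed N G key i v ! j) ` nbrs G u"
    have "Max ?A \<in> ?A"
      using False finite_nbrs[OF assms(1)] by (intro Max_in) auto
    then obtain v where v: "v \<in> nbrs G u" "Max ?A = embed N G key i v ! j" by blast
    then have "v \<in> verts G" using nbrs_subset[OF assms(1)] by blast
    from terms[OF this] obtain f y where "f \<in> emb_terms n N i" "range y \<subseteq> verts G"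
      "embed N G key i v = f (\<lambda>k. key (y k))" by auto
    with False v(2) show ?thesis
      by (intro bexI[of _ f] exI[of _ y]) (auto simp: nbr_max_def)
  qed
  then obtain g y where g: "\<And>j. j < dims N ! i \<Longrightarrow> g j \<in> emb_terms n N i"
    "\<And>j. j < dims N ! i \<Longrightarrow> range (y j) \<subseteq> verts G"
    "\<And>j. j < dims N ! i \<Longrightarrow> nbr_max G (embed N G key i) j u = g j (\<lambda>k. key (y j k)) ! j"
    by metis
  obtain f y0 where f: "f \<in> emb_terms n N i" "range y0 \<subseteq> verts G"
    "embed N G key i u = f (\<lambda>k. key (y0 k))"
    using terms[OF u] by auto
  define g' where "g' = restrict g {..<dims N ! i}"
  \<comment> \<open>Blocks belonging to no coordinate are filled with \<open>u\<close> to keep the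
    range inside the vertices.\<close>
  define x where "x a = (case prod_decode a of (0, k) \<Rightarrow> y0 k
      | (Suc j, k) \<Rightarrow> if j < dims N ! i then y j k else u)" for a
  have "y j k \<in> verts G" if "j < dims N ! i" for j k
    using g(2)[OF that] by auto
  then have "x a \<in> verts G" for a
    using f(2) u by (auto simp: x_def split: prod.split nat.split)
  then have "range x \<subseteq> verts G" by auto
  moreover have "layer_witness N G key i u f g' x"
    by (simp add: layer_witness_def f(3) g(3) x_def g'_def)
  moreover have "g' \<in> {..<dims N ! i} \<rightarrow>\<^sub>E emb_terms n N i"
    by (auto simp: g'_def g(1))
  ultimately show ?thesis using f(1) by blast
qed

text \<open>Names for all vertices at one layer combine, by \<open>ex_layer_witness\<close>, to
  names at the next. Keys are arbitrary here and the terms are the same for all graphs; this leaves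
  only finitely many comparisons to control.\<close>

lemma embed_eq_emb_term:
  assumes "is_gnn n N" and "local_max N" and "is_graph n G"
    and "i \<le> length (layers N)" and "u \<in> verts G"
  shows "\<exists>f\<in>emb_terms n N i. \<exists>y. range y \<subseteq> verts G \<and> embed N G key i u = f (\<lambda>k. key (y k))"
  using assms(4,5)
proof (induction i arbitrary: u)
  case 0
  have "length (lab G u) = n"
    using assms(3) 0 by (auto simp: is_graph_def)
  then have "(\<lambda>x. map of_bool (lab G u) @ [x 0]) \<in> emb_terms n N 0"
    by auto
  moreover have "range (\<lambda>_ :: nat. u) \<subseteq> verts G" using 0 by auto
  ultimately show ?case
    by (intro bexI exI[of _ "\<lambda>_. u"]) (auto simp: embed_0 initial_emb_def)
next
  case (Suc i)
  then have i: "i < length (layers N)" by simp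
  have "\<exists>f\<in>emb_terms n N i. \<exists>g\<in>{..<dims N ! i} \<rightarrow>\<^sub>E emb_terms n N i. \<exists>x.
      range x \<subseteq> verts G \<and> layer_witness N G key i u f g x"
    by (rule ex_layer_witness[OF assms(3) Suc.prems(2) Suc.IH[OF less_imp_le[OF i]]])
  then obtain f g x where fg: "f \<in> emb_terms n N i" "g \<in> {..<dims N ! i} \<rightarrow>\<^sub>E emb_terms n N i"
    and x: "range x \<subseteq> verts G" "layer_witness N G key i u f g x"
    by (elim bexE exE conjE) (rule that)
  show ?case
    by (intro bexI[OF _ layer_term_in_emb_terms[OF fg]] exI[of _ x] conjI x(1)
        embed_Suc_layer_witness[OF assms(1-3) i Suc.prems(2) x(2)])
qed

section \<open>Definability of embeddings\<close>

text \<open>Interleaving turns a comparison of two terms into one relation on one sequence, the form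
  treated by \<open>ramsey_order_uniform\<close>.\<close>

definition paired ::
  "('b \<Rightarrow> 'c \<Rightarrow> bool) \<Rightarrow> ((nat \<Rightarrow> 'a) \<Rightarrow> 'b) \<Rightarrow> ((nat \<Rightarrow> 'a) \<Rightarrow> 'c) \<Rightarrow> (nat \<Rightarrow> 'a) \<Rightarrow> bool" where
  "paired R f g x \<longleftrightarrow> R (f (\<lambda>k. x (2 * k))) (g (\<lambda>k. x (2 * k + 1)))"

lemma finitary_paired: "finitary f \<Longrightarrow> finitary g \<Longrightarrow> finitary (paired R f g)"
  unfolding paired_def[abs_def] by (rule finitary_compose2[where h = R]; rule finitary_reindex)

lemma definable_paired:
  fixes \<rho>\<^sub>1 \<rho>\<^sub>2 :: "nat \<Rightarrow> 'i::countable"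
  assumes "order_uniform s (paired R f g)"
  shows "definable n (\<lambda>G r (\<sigma> :: 'i \<Rightarrow> 'v).
    R (f (\<lambda>k. key_of s r (\<sigma> (\<rho>\<^sub>1 k)))) (g (\<lambda>k. key_of s r (\<sigma> (\<rho>\<^sub>2 k)))))"
  using definable_order_uniform[OF assms,
      of n "\<lambda>a. if even a then \<rho>\<^sub>1 (a div 2) else \<rho>\<^sub>2 (a div 2)"]
  by (simp add: paired_def)

text \<open>Equality recognises the value of an embedding, also after the last layer; coordinate
  order recognises a maximum, which is taken only over inputs of a layer, whence the strict bound on
  \<open>i\<close>; positivity is for acceptance.\<close>

locale uniform_keys =
  fixes n :: nat and N :: gnn and s :: "nat \<Rightarrow> real"
  assumes gnn: "is_gnn n N" and lmax: "local_max N"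
    and uniform_eq: "\<And>i f g. i \<le> length (layers N) \<Longrightarrow> f \<in> emb_terms n N i \<Longrightarrow>
      g \<in> emb_terms n N i \<Longrightarrow> order_uniform s (paired (=) f g)"
    and uniform_le: "\<And>i f g j. i < length (layers N) \<Longrightarrow> f \<in> emb_terms n N i \<Longrightarrow>
      g \<in> emb_terms n N i \<Longrightarrow> j < dims N ! i \<Longrightarrow> order_uniform s (paired (\<lambda>a b. a ! j \<le> b ! j) f g)"
    and uniform_pos: "\<And>f. f \<in> emb_terms n N (length (layers N)) \<Longrightarrow>
      order_uniform s (\<lambda>x. hd (f x) > 0)"
begin

text \<open>\<open>None\<close> stands for the vertex and \<open>Some k\<close> for the key
  arguments. An induction hypothesis has one fixed index type; this transfers it to the sum types
  created by quantification.\<close>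

lemma definable_embed_reindex:
  fixes w :: "'i::countable" and \<rho> :: "nat \<Rightarrow> 'i"
  assumes "definable n (\<lambda>G r (\<sigma> :: nat option \<Rightarrow> 'v).
      embed N G (key_of s r) i (\<sigma> None) = f (\<lambda>k. key_of s r (\<sigma> (Some k))))"
  shows "definable n (\<lambda>G r (\<sigma> :: 'i \<Rightarrow> 'v).
      embed N G (key_of s r) i (\<sigma> w) = f (\<lambda>k. key_of s r (\<sigma> (\<rho> k))))"
  using definable_reindex[OF assms, of "case_option w \<rho>"] by simp

text \<open>A maximum is \<open>c\<close> iff there is no neighbour and \<open>c = 0\<close>, or
  some neighbour has coordinate \<open>c\<close> and none exceeds it. Neighbours are accessed
  through names of their embeddings, recognised by \<open>IH\<close>. Equality of coordinates
  becomes two inequalities so that \<open>uniform_le\<close> applies.\<close>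

lemma definable_nbr_max:
  fixes z :: "'i::countable" and \<rho> :: "nat \<Rightarrow> 'i"
  assumes i: "i < length (layers N)" and j: "j < dims N ! i" and g: "g \<in> emb_terms n N i"
    and IH: "\<And>f. f \<in> emb_terms n N i \<Longrightarrow> definable n (\<lambda>G r (\<sigma> :: nat option \<Rightarrow> 'v).
      embed N G (key_of s r) i (\<sigma> None) = f (\<lambda>k. key_of s r (\<sigma> (Some k))))"
  shows "definable n (\<lambda>G r (\<sigma> :: 'i \<Rightarrow> 'v).
    nbr_max G (embed N G (key_of s r) i) j (\<sigma> z) = g (\<lambda>k. key_of s r (\<sigma> (\<rho> k))) ! j)"
proof -
  let ?T = "emb_terms n N i"
  \<comment> \<open>Zero is a term, so the comparison of a value with \<open>0\<close> is also an
    instance of \<open>uniform_le\<close>.\<close>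
  let ?zero = "\<lambda>_ :: nat \<Rightarrow> real. replicate (dims N ! i) (0 :: real)"
  note le = definable_paired[OF uniform_le[OF i _ _ j]]
  \<comment> \<open>\<open>definable_all\<close> quantifies sequences; a single vertex is entry
    \<open>0\<close> of one.\<close>
  define isolated where "isolated G u \<longleftrightarrow> (\<forall>x :: nat \<Rightarrow> 'v. range x \<subseteq> verts G \<longrightarrow> (u, x 0) \<notin> edges G)"
    for G :: "'v lgraph" and u
  \<comment> \<open>In each block \<open>x\<close> of vertices, \<open>x 0\<close> is a neighbour and the others witness its embedding.\<close>
  define attained where "attained G r u x h y \<longleftrightarrow>
      (u, x 0) \<in> edges G \<and>
      embed N G (key_of s r) i (x 0) = h (\<lambda>k. key_of s r (x (Suc k))) \<and>
      h (\<lambda>k. key_of s r (x (Suc k))) ! j \<le> g (\<lambda>k. key_of s r (y k)) ! j \<and>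
      g (\<lambda>k. key_of s r (y k)) ! j \<le> h (\<lambda>k. key_of s r (x (Suc k))) ! j"
    for G :: "'v lgraph" and r u x h y
  define bounded where "bounded G r u x h y \<longleftrightarrow>
      ((u, x 0) \<in> edges G \<and>
       embed N G (key_of s r) i (x 0) = h (\<lambda>k. key_of s r (x (Suc k))) \<longrightarrow>
       h (\<lambda>k. key_of s r (x (Suc k))) ! j \<le> g (\<lambda>k. key_of s r (y k)) ! j)"
    for G :: "'v lgraph" and r u x h y
  have attained: "definable n (\<lambda>G r (\<sigma> :: 'i \<Rightarrow> 'v).
      \<exists>x. range x \<subseteq> verts G \<and> attained G r (\<sigma> z) x h (\<lambda>k. \<sigma> (\<rho> k)))" if "h \<in> ?T" for h
    unfolding attained_def
    by (rule definable_ex)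
      (intro definable_conj definable_edge definable_embed_reindex[OF IH[OF that]]
        le[OF that g] le[OF g that])
  have bounded: "definable n (\<lambda>G r (\<sigma> :: 'i \<Rightarrow> 'v).
      \<forall>x. range x \<subseteq> verts G \<longrightarrow> bounded G r (\<sigma> z) x h (\<lambda>k. \<sigma> (\<rho> k)))" if "h \<in> ?T" for h
    unfolding bounded_def
    by (rule definable_all)
      (intro definable_imp definable_conj definable_edge definable_embed_reindex[OF IH[OF that]]
        le[OF that g])
  have isolated: "definable n (\<lambda>G r (\<sigma> :: 'i \<Rightarrow> 'v). isolated G (\<sigma> z))"
    unfolding isolated_def by (rule definable_all) (intro definable_not definable_edge)
  have "definable n (\<lambda>G r (\<sigma> :: 'i \<Rightarrow> 'v).
      (isolated G (\<sigma> z) \<and>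
       ?zero (\<lambda>k. key_of s r (\<sigma> (\<rho> k))) ! j \<le> g (\<lambda>k. key_of s r (\<sigma> (\<rho> k))) ! j \<and>
       g (\<lambda>k. key_of s r (\<sigma> (\<rho> k))) ! j \<le> ?zero (\<lambda>k. key_of s r (\<sigma> (\<rho> k))) ! j) \<or>
      ((\<exists>h\<in>?T. \<exists>x. range x \<subseteq> verts G \<and> attained G r (\<sigma> z) x h (\<lambda>k. \<sigma> (\<rho> k))) \<and>
       (\<forall>h\<in>?T. \<forall>x. range x \<subseteq> verts G \<longrightarrow> bounded G r (\<sigma> z) x h (\<lambda>k. \<sigma> (\<rho> k)))))"
    by (intro definable_disj definable_conj definable_bex definable_ball finite_emb_terms
        isolated attained bounded le[OF zero_in_emb_terms g] le[OF g zero_in_emb_terms])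
  then show ?thesis
  proof (rule definable_cong)
    fix G :: "'v lgraph" and r and \<sigma> :: "'i \<Rightarrow> 'v"
    assume G: "is_graph n G" and \<sigma>: "range \<sigma> \<subseteq> verts G"
    let ?e = "embed N G (key_of s r) i" and ?c = "g (\<lambda>k. key_of s r (\<sigma> (\<rho> k))) ! j"
    let ?u = "\<sigma> z"
    have fin: "finite (nbrs G ?u)" by (rule finite_nbrs[OF G])
    \<comment> \<open>Every neighbour has a name, so quantifying over named neighbours misses
      none.\<close>
    have witness: "\<exists>h\<in>?T. \<exists>x. range x \<subseteq> verts G \<and> x 0 = w \<and> ?e w = h (\<lambda>k. key_of s r (x (Suc k)))"
      if "w \<in> nbrs G ?u" for w
    proof -
      have w: "w \<in> verts G" using that nbrs_subset[OF G] by blast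
      from embed_eq_emb_term[OF gnn lmax G _ this, of i "key_of s r"] i obtain h y
        where h: "h \<in> ?T" "range y \<subseteq> verts G" "?e w = h (\<lambda>k. key_of s r (y k))" by auto
      have "range (case_nat w y) \<subseteq> verts G"
        using w h(2) by (auto simp: image_subset_iff split: nat.split)
      with h show ?thesis
        by (intro bexI[of _ h] exI[of _ "case_nat w y"]) auto
    qed
    have iso: "isolated G ?u \<longleftrightarrow> nbrs G ?u = {}"
    proof
      assume iso: "isolated G ?u"
      show "nbrs G ?u = {}"
      proof (rule ccontr)
        assume "nbrs G ?u \<noteq> {}"
        then obtain w where w: "w \<in> nbrs G ?u" by blast
        then have "range (\<lambda>_ :: nat. w) \<subseteq> verts G" using nbrs_subset[OF G] by auto
        with iso w show False unfolding isolated_def nbrs_def by blast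
      qed
    qed (auto simp: isolated_def nbrs_def)
    have att: "(\<exists>h\<in>?T. \<exists>x. range x \<subseteq> verts G \<and> attained G r ?u x h (\<lambda>k. \<sigma> (\<rho> k))) \<longleftrightarrow>
        (\<exists>w\<in>nbrs G ?u. ?e w ! j = ?c)" (is "?L \<longleftrightarrow> ?R")
    proof
      assume ?L
      then obtain h x where "attained G r ?u x h (\<lambda>k. \<sigma> (\<rho> k))" by blast
      then show ?R
        by (intro bexI[of _ "x 0"]) (auto simp: attained_def nbrs_def)
    next
      assume ?R
      then obtain w where w: "w \<in> nbrs G ?u" "?e w ! j = ?c" by blast
      from witness[OF this(1)] obtain h x where "h \<in> ?T" "range x \<subseteq> verts G" "x 0 = w"
        "?e w = h (\<lambda>k. key_of s r (x (Suc k)))" by blast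
      with w show ?L
        by (intro bexI[of _ h] exI[of _ x]) (auto simp: attained_def nbrs_def)
    qed
    have bnd: "(\<forall>h\<in>?T. \<forall>x. range x \<subseteq> verts G \<longrightarrow> bounded G r ?u x h (\<lambda>k. \<sigma> (\<rho> k))) \<longleftrightarrow>
        (\<forall>w\<in>nbrs G ?u. ?e w ! j \<le> ?c)" (is "?L \<longleftrightarrow> ?R")
    proof
      assume L: ?L
      show ?R
      proof
        fix w
        assume w: "w \<in> nbrs G ?u"
        from witness[OF w] obtain h x where hx: "h \<in> ?T" "range x \<subseteq> verts G" "x 0 = w"
          "?e w = h (\<lambda>k. key_of s r (x (Suc k)))" by blast
        with L have "bounded G r ?u x h (\<lambda>k. \<sigma> (\<rho> k))" by blast
        with hx w show "?e w ! j \<le> ?c"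
          by (simp add: bounded_def nbrs_def)
      qed
    next
      assume R: ?R
      have "bounded G r ?u x h (\<lambda>k. \<sigma> (\<rho> k))" for h x
        unfolding bounded_def
      proof (intro impI, elim conjE)
        assume "(?u, x 0) \<in> edges G" "?e (x 0) = h (\<lambda>k. key_of s r (x (Suc k)))"
        with R show "h (\<lambda>k. key_of s r (x (Suc k))) ! j \<le> ?c"
          by (auto simp: nbrs_def dest!: spec[of _ "x 0"])
      qed
      then show ?L by blast
    qed
    have "nbr_max G ?e j ?u = ?c \<longleftrightarrow> nbrs G ?u = {} \<and> ?c = 0 \<or>
        (\<exists>w\<in>nbrs G ?u. ?e w ! j = ?c) \<and> (\<forall>w\<in>nbrs G ?u. ?e w ! j \<le> ?c)"
    proof (cases "nbrs G ?u = {}")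
      case False
      then have "Max ((\<lambda>v. ?e v ! j) ` nbrs G ?u) = ?c \<longleftrightarrow>
          ?c \<in> (\<lambda>v. ?e v ! j) ` nbrs G ?u \<and> (\<forall>a\<in>(\<lambda>v. ?e v ! j) ` nbrs G ?u. a \<le> ?c)"
        using fin by (intro Max_eq_iff) auto
      moreover have "?c \<in> (\<lambda>v. ?e v ! j) ` nbrs G ?u \<longleftrightarrow> (\<exists>w\<in>nbrs G ?u. ?e w ! j = ?c)"
        by force
      ultimately show ?thesis
        using False by (simp add: nbr_max_def)
    qed (auto simp: nbr_max_def)
    moreover have "?zero (\<lambda>k. key_of s r (\<sigma> (\<rho> k))) ! j = 0"
      using j by simp
    ultimately show "nbr_max G ?e j ?u = ?c \<longleftrightarrow>
        (isolated G ?u \<and> ?zero (\<lambda>k. key_of s r (\<sigma> (\<rho> k))) ! j \<le> ?c \<and>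
          ?c \<le> ?zero (\<lambda>k. key_of s r (\<sigma> (\<rho> k))) ! j) \<or>
        ((\<exists>h\<in>?T. \<exists>x. range x \<subseteq> verts G \<and> attained G r ?u x h (\<lambda>k. \<sigma> (\<rho> k))) \<and>
         (\<forall>h\<in>?T. \<forall>x. range x \<subseteq> verts G \<longrightarrow> bounded G r ?u x h (\<lambda>k. \<sigma> (\<rho> k))))"
      unfolding iso att bnd by auto
  qed
qed

text \<open>One layer up, the value is that of \<open>f\<close> iff some layer witness yields a
  \<open>layer_term\<close> equal to it. Both sides are terms of that layer, so
  \<open>uniform_eq\<close> expresses the equality through the order, whatever \<open>com\<close>
  computes.\<close>

lemma definable_embed:
  assumes "i \<le> length (layers N)" and "f \<in> emb_terms n N i"
  shows "definable n (\<lambda>G r (\<sigma> :: nat option \<Rightarrow> 'v).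
      embed N G (key_of s r) i (\<sigma> None) = f (\<lambda>k. key_of s r (\<sigma> (Some k))))"
  using assms
proof (induction i arbitrary: f)
  case 0
  have "definable n (\<lambda>G r (\<sigma> :: nat option \<Rightarrow> 'v). \<exists>l\<in>{l. length l = n}. lab G (\<sigma> None) = l \<and>
      map of_bool l @ [key_of s r (\<sigma> None)] = f (\<lambda>k. key_of s r (\<sigma> (Some k))))"
  proof (intro definable_bex finite_bool_lists definable_conj)
    fix l :: "bool list"
    assume l: "l \<in> {l. length l = n}"
    then show "definable n (\<lambda>G r (\<sigma> :: nat option \<Rightarrow> 'v). lab G (\<sigma> None) = l)"
      by (simp add: definable_label)
    from l have "(\<lambda>x. map of_bool l @ [x 0]) \<in> emb_terms n N 0" by auto
    \<comment> \<open>The label term reads only entry \<open>0\<close> of its argument, the key of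
      the vertex itself.\<close>
    from definable_paired[OF uniform_eq[OF 0(1) this 0(2)]]
    show "definable n (\<lambda>G r (\<sigma> :: nat option \<Rightarrow> 'v).
        map of_bool l @ [key_of s r (\<sigma> None)] = f (\<lambda>k. key_of s r (\<sigma> (Some k))))" .
  qed
  then show ?case
    by (rule definable_cong) (auto simp: embed_0 initial_emb_def is_graph_def)
next
  case (Suc i)
  then have i: "i < length (layers N)" by simp
  let ?T = "emb_terms n N i" and ?d = "dims N ! i" and ?L = "layers N ! i"
  note IH = Suc.IH[OF less_imp_le[OF i]]
  have step: "definable n (\<lambda>G r (\<sigma> :: nat option \<Rightarrow> 'v). \<exists>x. range x \<subseteq> verts G \<and>
      layer_witness N G (key_of s r) i (\<sigma> None) h g x \<and>
      layer_term ?L ?d h g (\<lambda>k. key_of s r (x k)) = f (\<lambda>k. key_of s r (\<sigma> (Some k))))"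
    if h: "h \<in> ?T" and g: "g \<in> {..<?d} \<rightarrow>\<^sub>E ?T" for h g
    unfolding layer_witness_def
  proof (rule definable_ex, intro definable_conj definable_ball finite_lessThan)
    fix j
    assume j: "j \<in> {..<?d}"
    then have "g j \<in> ?T" using g by auto
    with j show "definable n (\<lambda>G r (\<tau> :: nat option + nat \<Rightarrow> 'v).
        nbr_max G (embed N G (key_of s r) i) j (\<tau> (Inl None)) =
        g j (\<lambda>k. key_of s r (\<tau> (Inr (prod_encode (Suc j, k))))) ! j)"
      by (intro definable_nbr_max[OF i _ \<open>g j \<in> ?T\<close> IH]) auto
  next
    show "definable n (\<lambda>G r (\<tau> :: nat option + nat \<Rightarrow> 'v).
        embed N G (key_of s r) i (\<tau> (Inl None)) =
        h (\<lambda>k. key_of s r (\<tau> (Inr (prod_encode (0, k))))))"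
      by (rule definable_embed_reindex[OF IH[OF h]])
    show "definable n (\<lambda>G r (\<tau> :: nat option + nat \<Rightarrow> 'v).
        layer_term ?L ?d h g (\<lambda>k. key_of s r (\<tau> (Inr k))) =
        f (\<lambda>k. key_of s r (\<tau> (Inl (Some k)))))"
      by (rule definable_paired[OF uniform_eq[OF Suc.prems(1) layer_term_in_emb_terms[OF h g] Suc.prems(2)]])
  qed
  have "definable n (\<lambda>G r (\<sigma> :: nat option \<Rightarrow> 'v). \<exists>h\<in>?T. \<exists>g\<in>{..<?d} \<rightarrow>\<^sub>E ?T. \<exists>x. range x \<subseteq> verts G \<and>
      layer_witness N G (key_of s r) i (\<sigma> None) h g x \<and>
      layer_term ?L ?d h g (\<lambda>k. key_of s r (x k)) = f (\<lambda>k. key_of s r (\<sigma> (Some k))))"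
    by (intro definable_bex finite_emb_terms finite_PiE finite_lessThan step)
  then show ?case
  proof (rule definable_cong)
    fix G :: "'v lgraph" and r and \<sigma> :: "nat option \<Rightarrow> 'v"
    assume G: "is_graph n G" and \<sigma>: "range \<sigma> \<subseteq> verts G"
    then have u: "\<sigma> None \<in> verts G" by auto
    \<comment> \<open>Every witness yields the actual embedding, so any choice of the quantifiers is
      sound.\<close>
    note val = embed_Suc_layer_witness[OF gnn lmax G i u]
    have "\<exists>h\<in>?T. \<exists>g\<in>{..<?d} \<rightarrow>\<^sub>E ?T. \<exists>x. range x \<subseteq> verts G \<and>
        layer_witness N G (key_of s r) i (\<sigma> None) h g x"
      using i by (intro ex_layer_witness[OF G u] embed_eq_emb_term[OF gnn lmax G]) auto
    then obtain h g x where hgx: "h \<in> ?T" "g \<in> {..<?d} \<rightarrow>\<^sub>E ?T" "range x \<subseteq> verts G"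
      "layer_witness N G (key_of s r) i (\<sigma> None) h g x"
      by (elim bexE exE conjE) (rule that)
    show "embed N G (key_of s r) (Suc i) (\<sigma> None) = f (\<lambda>k. key_of s r (\<sigma> (Some k))) \<longleftrightarrow>
        (\<exists>h\<in>?T. \<exists>g\<in>{..<?d} \<rightarrow>\<^sub>E ?T. \<exists>x. range x \<subseteq> verts G \<and>
          layer_witness N G (key_of s r) i (\<sigma> None) h g x \<and>
          layer_term ?L ?d h g (\<lambda>k. key_of s r (x k)) = f (\<lambda>k. key_of s r (\<sigma> (Some k))))"
      (is "?lhs \<longleftrightarrow> ?rhs")
    proof
      assume ?lhs
      then have "layer_term ?L ?d h g (\<lambda>k. key_of s r (x k)) = f (\<lambda>k. key_of s r (\<sigma> (Some k)))"
        using val[OF hgx(4)] by simp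
      with hgx show ?rhs
        by (intro bexI[of _ h] bexI[of _ g] exI[of _ x] conjI)
    next
      assume ?rhs
      then show ?lhs
        by (elim bexE exE conjE) (simp add: val)
    qed
  qed
qed

text \<open>The output is read off any name of the last embedding, and \<open>uniform_pos\<close>
  expresses its sign.\<close>

lemma definable_accepts:
  "definable n (\<lambda>G r (\<sigma> :: nat \<Rightarrow> 'v). gnn_accepts N G (key_of s r) (\<sigma> 0))"
proof -
  let ?l = "length (layers N)"
  have "definable n (\<lambda>G r (\<sigma> :: nat \<Rightarrow> 'v). \<exists>f\<in>emb_terms n N ?l. \<exists>y. range y \<subseteq> verts G \<and>
      embed N G (key_of s r) ?l (\<sigma> 0) = f (\<lambda>k. key_of s r (y k)) \<and>
      hd (f (\<lambda>k. key_of s r (y k))) > 0)"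
  proof (intro definable_bex finite_emb_terms)
    fix f
    assume f: "f \<in> emb_terms n N ?l"
    show "definable n (\<lambda>G r (\<sigma> :: nat \<Rightarrow> 'v). \<exists>y. range y \<subseteq> verts G \<and>
        embed N G (key_of s r) ?l (\<sigma> 0) = f (\<lambda>k. key_of s r (y k)) \<and>
        hd (f (\<lambda>k. key_of s r (y k))) > 0)"
      by (rule definable_ex) (intro definable_conj
          definable_embed_reindex[OF definable_embed[OF order_refl f]]
          definable_order_uniform[OF uniform_pos[OF f]])
  qed
  then show ?thesis
  proof (rule definable_cong)
    fix G :: "'v lgraph" and r and \<sigma> :: "nat \<Rightarrow> 'v"
    assume G: "is_graph n G" and "range \<sigma> \<subseteq> verts G"
    then have "\<sigma> 0 \<in> verts G" by auto
    from embed_eq_emb_term[OF gnn lmax G order_refl this, of "key_of s r"]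
    obtain f y where fy: "f \<in> emb_terms n N ?l" "range y \<subseteq> verts G"
      "embed N G (key_of s r) ?l (\<sigma> 0) = f (\<lambda>k. key_of s r (y k))"
      by auto
    have accepts: "gnn_accepts N G (key_of s r) (\<sigma> 0) \<longleftrightarrow> hd (embed N G (key_of s r) ?l (\<sigma> 0)) > 0"
      by (simp add: gnn_accepts_def gnn_output_def embed_def)
    show "gnn_accepts N G (key_of s r) (\<sigma> 0) \<longleftrightarrow>
        (\<exists>f\<in>emb_terms n N ?l. \<exists>y. range y \<subseteq> verts G \<and>
          embed N G (key_of s r) ?l (\<sigma> 0) = f (\<lambda>k. key_of s r (y k)) \<and>
          hd (f (\<lambda>k. key_of s r (y k))) > 0)"
      (is "_ \<longleftrightarrow> ?R")
    proof
      assume "gnn_accepts N G (key_of s r) (\<sigma> 0)"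
      with fy show ?R
        unfolding accepts by (intro bexI[of _ f] exI[of _ y]) simp_all
    next
      assume ?R
      then show "gnn_accepts N G (key_of s r) (\<sigma> 0)"
        unfolding accepts by (elim bexE exE conjE) simp
    qed
  qed
qed

end

section \<open>Choice of the keys and the final formula\<close>

text \<open>The comparisons of all layers are collected before Ramsey's theorem is applied, because
  all layers must share one \<open>s\<close>.\<close>

lemma ex_uniform_keys:
  assumes "is_gnn n N" and "local_max N"
  obtains s where "inj s" and "uniform_keys n N s"
proof -
  let ?l = "length (layers N)"
  define \<R> where "\<R> =
    (\<Union>i\<in>{..?l}. (\<lambda>(f, g). paired (=) f g) ` (emb_terms n N i \<times> emb_terms n N i)) \<union>
    (\<Union>i\<in>{..<?l}. (\<lambda>(j, f, g). paired (\<lambda>a b. a ! j \<le> b ! j) f g) `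
      ({..<dims N ! i} \<times> emb_terms n N i \<times> emb_terms n N i)) \<union>
    (\<lambda>f x. hd (f x) > 0) ` emb_terms n N ?l"
  have "finite \<R>"
    unfolding \<R>_def by (intro finite_UnI finite_UN_I finite_imageI finite_cartesian_product
        finite_emb_terms finite_atMost finite_lessThan)
  moreover have "finitary R" if "R \<in> \<R>" for R
    using that unfolding \<R>_def
    by (auto intro!: finitary_paired finitary_compose[where h = "\<lambda>v. hd v > 0"]
        intro: finitary_emb_terms)
  ultimately obtain s where s: "inj s" "\<And>R. R \<in> \<R> \<Longrightarrow> order_uniform s R"
    using ramsey_order_uniform by blast
  have "uniform_keys n N s"
  proof
    fix i f g
    assume "i \<le> ?l" "f \<in> emb_terms n N i" "g \<in> emb_terms n N i"
    then have "paired (=) f g \<in> \<R>" unfolding \<R>_def by blast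
    then show "order_uniform s (paired (=) f g)" by (rule s)
  next
    fix i f g j
    assume "i < ?l" "f \<in> emb_terms n N i" "g \<in> emb_terms n N i" "j < dims N ! i"
    then have "paired (\<lambda>a b. a ! j \<le> b ! j) f g \<in> \<R>"
      unfolding \<R>_def
      by (intro UnI1[OF UnI2] UN_I[of i] image_eqI[of _ _ "(j, f, g)"]) simp_all
    then show "order_uniform s (paired (\<lambda>a b. a ! j \<le> b ! j) f g)" by (rule s)
  next
    fix f
    assume "f \<in> emb_terms n N ?l"
    then have "(\<lambda>x. hd (f x) > 0) \<in> \<R>"
      unfolding \<R>_def by (intro UnI2 imageI)
    then show "order_uniform s (\<lambda>x. hd (f x) > 0)" by (rule s)
  qed (fact assms)+
  with s(1) that show thesis by blast
qed

text \<open>\<open>fo_query\<close> demands that some order satisfies the formula, so each graph in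
  the query has to possess one.\<close>

lemma ex_vertex_order:
  assumes "is_graph n G"
  shows "\<exists>r. r \<in> vertex_orders G"
proof -
  have "finite (verts G)" using assms by (simp add: is_graph_def)
  then obtain h :: "'a \<Rightarrow> nat" where h: "inj_on h (verts G)"
    using finite_imp_inj_to_nat_seg[of "verts G"] by auto
  let ?r = "{(v, w) \<in> verts G \<times> verts G. h v < h w}"
  have "trans ?r" by (auto intro!: transI)
  moreover have "irrefl ?r" by (auto simp: irrefl_def)
  moreover have "total_on (verts G) ?r"
    using h by (auto simp: total_on_def dest: inj_onD intro: linorder_neqE_nat)
  ultimately have "?r \<in> vertex_orders G"
    by (auto simp: vertex_orders_def strict_linear_order_on_def)
  then show ?thesis by blast
qed

theorem theorem4p13:
  fixes n :: nat
    and N :: gnn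
    and Q :: "('v::infinite lgraph \<times> 'v) set"
  assumes "node_query n Q"
    and "is_gnn n N"
    and "local_max N"
    and "key_invariant TYPE('v) n N"
    and "Q = gnn_query n N"
  shows "Q \<in> OrdInvFO n"
proof -
  obtain s where s: "inj s" and "uniform_keys n N s"
    using ex_uniform_keys[OF assms(2,3)] by blast
  then interpret uniform_keys n N s by simp
  obtain \<phi> where \<phi>: "unary_formula n \<phi>"
    "\<And>(G :: 'v lgraph) r u. is_graph n G \<Longrightarrow> r \<in> vertex_orders G \<Longrightarrow> u \<in> verts G \<Longrightarrow>
      sat G r (\<lambda>_. u) \<phi> = gnn_accepts N G (key_of s r) u"
    using unary_formula_of_definable[OF definable_accepts] by blast
  \<comment> \<open>\<open>key_of s r\<close> is itself a keying, so by key-invariance its verdict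
    is that of all keyings. The right-hand side does not mention \<open>r\<close>, which yields
    order-invariance at once.\<close>
  have sat_iff: "sat G r (\<lambda>_. u) \<phi> \<longleftrightarrow> (\<forall>key\<in>keyings G. gnn_accepts N G key u)"
    if "(G, u) \<in> pointed_graphs n" "r \<in> vertex_orders G" for G :: "'v lgraph" and r u
  proof -
    have G: "is_graph n G" "u \<in> verts G"
      using that(1) by (auto simp: pointed_graphs_def)
    have "(\<forall>key\<in>keyings G. gnn_accepts N G key u) \<or> (\<forall>key\<in>keyings G. \<not> gnn_accepts N G key u)"
      using assms(4) that(1) unfolding key_invariant_def by blast
    with key_of_in_keyings[OF G(1) that(2) s] \<phi>(2)[OF G(1) that(2) G(2)] show ?thesis
      by blast
  qed
  have "order_invariant TYPE('v) n \<phi>"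
    unfolding order_invariant_def using sat_iff by blast
  moreover have "Q = fo_query n \<phi>"
    unfolding assms(5) gnn_query_def fo_query_def
    using sat_iff ex_vertex_order by (fastforce simp: pointed_graphs_def)
  ultimately show ?thesis
    unfolding OrdInvFO_def using \<phi>(1) by blast
qed

end
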